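(* Let $q$ be an odd prime power. The association scheme $\mathfrak{X}(\mathrm{P}\Omega(3,q),\mathcal{L}_+)$ determined by the action of $\mathrm{P}\Omega(3,q)$ on the set $\mathcal{L}_+$ of hyperbolic lines of the conic $\mathscr{O}$ in $\mathrm{PG}(2,q)$ is non-symmetric, with $(3q+5)/4$ classes if $q\equiv 1 \bmod 4$ and with $(3q+3)/4$ classes if $q\equiv 3\bmod 4$.
   Context: Association schemes: if a group $G$ acts transitively on a finite set $X$, the orbits of the induced diagonal action of $G$ on $X\times X$ are the relations of an association scheme, denoted $\mathfrak{X}(G,X)$. One of these relations is the diagonal $R_0=\{(x,x):x\in X\}$; if there are $d$ other relations $R_1,\dots,R_d$, the scheme is said to have $d$ classes. A relation $R$ is symmetric if $(x,y)\in R$ implies $(y,x)\in R$; the scheme is symmetric if all of its relations are symmetric, and non-symmetric otherwise. Geometry: $\mathbb{F}_q$ is the field with $q$ elements and $V=\mathbb{F}_q^3$ carries the quadratic form $Q(x_0,x_1,x_2)=x_1^2-x_0x_2$. In $\mathrm{PG}(2,q)$ (the projective plane on $V$) the conic is $\mathscr{O}=\{(\xi^2:\xi:1)\mid \xi\in\mathbb{F}_q\}\cup\{(1:0:0)\}$, the set of singular points of $Q$. A line $\ell$ of $\mathrm{PG}(2,q)$ is hyperbolic if $|\ell\cap\mathscr{O}|=2$; $\mathcal{L}_+$ is the set of hyperbolic lines. Group: for $A=\begin{pmatrix} a&b\\c&d\end{pmatrix}\in \mathrm{GL}(2,q)$ put $\rho(A)=\begin{pmatrix} a^2&2ab&b^2\\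 ac&ad+bc&bd\\ c^2&2cd&d^2\end{pmatrix}$. This induces an embedding $\rho$ of $\mathrm{PGL}(2,q)$ into $\mathrm{PGL}(3,q)$ whose image preserves $\mathscr{O}$, and $\mathrm{P}\Omega(3,q)=\rho(\mathrm{PSL}(2,q))$, where $\mathrm{PSL}(2,q)$ is regarded as a subgroup of $\mathrm{PGL}(2,q)$. The group $\mathrm{P}\Omega(3,q)$ acts on column vectors by left multiplication and hence acts on the lines of $\mathrm{PG}(2,q)$; its action on $\mathcal{L}_+$ is transitive (equivalently: it is the action of $\mathrm{PSL}(2,q)$ on the 2-element subsets of $\mathrm{PG}(1,q)$). *)

theory Defs
  imports
    "HOL-Analysis.Analysis"
    "HOL-Algebra.Group_Action"
    "HOL-Library.Disjoint_Sets"
    "HOL-Number_Theory.Prime_Powers"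
begin

text \<open>Association schemes are not assumed to be commutative: for a transitive group action the
  orbitals satisfy the axioms below, but not in general commutativity.\<close>

definition association_scheme :: "'a set \<Rightarrow> ('a \<times> 'a) set set \<Rightarrow> bool" where
  "association_scheme X S \<longleftrightarrow>
     finite X \<and> partition_on (X \<times> X) S \<and> Id_on X \<in> S \<and> (\<forall>R\<in>S. converse R \<in> S) \<and>
     (\<forall>R\<in>S. \<forall>T\<in>S. \<forall>U\<in>S. \<exists>p. \<forall>(x, y)\<in>U. card {z \<in> X. (x, z) \<in> R \<and> (z, y) \<in> T} = p)"

definition symmetric_scheme :: "('a \<times> 'a) set set \<Rightarrow> bool" where
  "symmetric_scheme S \<longleftrightarrow> (\<forall>R\<in>S. sym R)"

definition num_classes :: "'a set \<Rightarrow> ('a \<times> 'a) set set \<Rightarrow> nat" where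
  "num_classes X S = card (S - {Id_on X})"

definition orbital_scheme ::
    "('g, 'm) monoid_scheme \<Rightarrow> 'a set \<Rightarrow> ('g \<Rightarrow> 'a \<Rightarrow> 'a) \<Rightarrow> ('a \<times> 'a) set set" where
  "orbital_scheme G X \<phi> = orbits G (X \<times> X) (\<lambda>g. map_prod (\<phi> g) (\<phi> g))"


definition GL :: "('k::field ^ 'n ^ 'n) monoid" where
  "GL = \<lparr>carrier = {A. invertible A}, mult = (**), one = mat 1\<rparr>"

definition scalar_matrices :: "('k::field ^ 'n ^ 'n) set" where
  "scalar_matrices = {mat c | c. c \<noteq> 0}"

definition PGL :: "('k::field ^ 'n ^ 'n) set monoid" where
  "PGL = GL Mod scalar_matrices"

definition proj_class :: "'k::field ^ 'n ^ 'n \<Rightarrow> ('k ^ 'n ^ 'n) set" where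
  "proj_class A = scalar_matrices #>\<^bsub>GL\<^esub> A"

definition PSL :: "('k::field ^ 'n ^ 'n) set monoid" where
  "PSL = PGL\<lparr>carrier := proj_class ` {A. det A = 1}\<rparr>"

definition rho_mat :: "'k::field ^ 2 ^ 2 \<Rightarrow> 'k ^ 3 ^ 3" where
  "rho_mat A =
    (let a = A $ 1 $ 1; b = A $ 1 $ 2; c = A $ 2 $ 1; d = A $ 2 $ 2 in
      vector [vector [a\<^sup>2, 2 * a * b, b\<^sup>2],
              vector [a * c, a * d + b * c, b * d],
              vector [c\<^sup>2, 2 * c * d, d\<^sup>2]])"

text \<open>Below, \<^const>\<open>the_elem\<close> picks the common value that a map takes on all the representatives
  of an element of \<^const>\<open>PGL\<close>. For \<open>rho\<close> this is legitimate because \<open>rho_mat\<close> maps \<open>c A\<close> to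
  \<open>c\<^sup>2 rho_mat A\<close>, and for the action on points because \<open>c A\<close> and \<open>A\<close> map a subspace to the same
  subspace.\<close>

definition rho :: "('k::field ^ 2 ^ 2) set \<Rightarrow> ('k ^ 3 ^ 3) set" where
  "rho C = the_elem ((\<lambda>A. proj_class (rho_mat A)) ` C)"

definition POmega3 :: "('k::field ^ 3 ^ 3) set monoid" where
  "POmega3 = PGL\<lparr>carrier := rho ` carrier PSL\<rparr>"


text \<open>Points of the projective plane are one-dimensional subspaces of the vector space of column
  vectors; a line is the set of the points contained in a given two-dimensional subspace.\<close>

definition proj_points :: "('k::field ^ 3) set set" where
  "proj_points = {P. vec.subspace P \<and> vec.dim P = 1}"

definition proj_lines :: "('k::field ^ 3) set set set" where
  "proj_lines = {{P \<in> proj_points. P \<subseteq> W} | W. vec.subspace W \<and> vec.dim W = 2}"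

definition proj_point :: "'k::field \<Rightarrow> 'k \<Rightarrow> 'k \<Rightarrow> ('k ^ 3) set" where
  "proj_point x y z = vec.span {vector [x, y, z]}"

definition conic :: "('k::field ^ 3) set set" where
  "conic = {proj_point (\<xi>\<^sup>2) \<xi> 1 | \<xi>. True} \<union> {proj_point 1 0 0}"

definition hyperbolic_lines :: "('k::field ^ 3) set set set" where
  "hyperbolic_lines = {l \<in> proj_lines. card (l \<inter> conic) = 2}"

definition point_action :: "('k::field ^ 3 ^ 3) set \<Rightarrow> ('k ^ 3) set \<Rightarrow> ('k ^ 3) set" where
  "point_action C P = the_elem ((\<lambda>A. (*v) A ` P) ` C)"

definition line_action :: "('k::field ^ 3 ^ 3) set \<Rightarrow> ('k ^ 3) set set \<Rightarrow> ('k ^ 3) set set" where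
  "line_action C l = point_action C ` l"

end

theory Submission
  imports Defs "HOL-Number_Theory.Residues"
begin

text \<open>The pole of a hyperbolic line is a point on which the quadratic form takes nonzero square
  values, so hyperbolic lines correspond to vectors \<open>v = (y, x, z)\<close> with \<open>x\<^sup>2 - y z = 1\<close>, up to sign
  (\<open>hyperbolic_lines_eq\<close>, \<open>polar_line_eq_iff\<close>). On these vectors the group acts through the matrices
  of determinant one, as isometries, and it is transitive (\<open>exists_rho_e1\<close>). The orbitals of a
  transitive action always form an association scheme (\<open>association_scheme_orbital_scheme\<close>).

  The orbitals correspond to the orbits on lines of the stabilizer of the base line, whose pole is
  \<open>(0, 1, 0)\<close>. This stabilizer is the group of monomial matrices, so its orbits can be read off from
  coordinates: the orbit of \<open>v\<close> is determined by \<open>x\<^sup>2\<close> and by the quadratic characters of \<open>xy\<close> and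
  \<open>-xz\<close> as an unordered pair, with a small modification for \<open>x = 0\<close>
  (\<open>base_orbital_eq_iff_orbital_inv\<close>). Since \<open>y z = x\<^sup>2 - 1\<close>, a square \<open>s = x\<^sup>2\<close> other than \<open>0\<close> and
  \<open>1\<close> yields two orbitals if \<open>1 - s\<close> is a square and one otherwise, \<open>s = 1\<close> yields three, and
  \<open>s = 0\<close> yields two or one depending on whether \<open>-1\<close> is a square (\<open>card_orbital_inv_image\<close>).
  What remains is the number of \<open>s\<close> such that \<open>s\<close> and \<open>1 - s\<close> are both nonzero squares. It is
  \<open>(q - 5) / 4\<close> if \<open>-1\<close> is a square and \<open>(q - 3) / 4\<close> otherwise (\<open>card_consecutive_squares\<close>), which
  also shows that \<open>-1\<close> is a square exactly if \<open>q mod 4 = 1\<close>.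

  For non-symmetry it suffices to exhibit two lines that no element of the group interchanges. An
  element that interchanges the base line and the line of \<open>v\<close> forces one of \<open>-2(1 + x)\<close> and
  \<open>-2(1 - x)\<close> to be a nonzero square, or \<open>x = 0\<close> and \<open>2\<close> to be one (\<open>interchange_imp_square\<close>), and a
  counting argument provides an \<open>x\<close> that avoids all this (\<open>exists_obstruction\<close>).\<close>

section \<open>The quadratic character of a finite field of odd order\<close>

definition quad_char :: "'k::field \<Rightarrow> int" where
  "quad_char x = (if x = 0 then 0 else if \<exists>y. x = y\<^sup>2 then 1 else -1)"

lemma quad_char_0 [simp]: "quad_char 0 = 0"
  and quad_char_1 [simp]: "quad_char 1 = 1"
  by (auto simp: quad_char_def intro: exI[of _ 1])

lemma quad_char_eq_0_iff [simp]: "quad_char x = 0 \<longleftrightarrow> x = 0"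
  by (auto simp: quad_char_def)

lemma quad_char_cases: "x \<noteq> 0 \<Longrightarrow> quad_char x = 1 \<or> quad_char x = -1"
  by (auto simp: quad_char_def)

lemma quad_char_eq_1_iff: "quad_char x = 1 \<longleftrightarrow> x \<noteq> 0 \<and> (\<exists>y. x = y\<^sup>2)"
  by (auto simp: quad_char_def)

lemma quad_char_square: "y \<noteq> 0 \<Longrightarrow> quad_char (y\<^sup>2) = 1"
  by (auto simp: quad_char_def)

lemma quad_char_square_mult:
  assumes "(t::'k::field) \<noteq> 0"
  shows "quad_char (t\<^sup>2 * x) = quad_char x"
proof -
  have "(\<exists>y. t\<^sup>2 * x = y\<^sup>2) \<longleftrightarrow> (\<exists>y. x = y\<^sup>2)"
  proof
    assume "\<exists>y. t\<^sup>2 * x = y\<^sup>2"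
    then obtain y where "t\<^sup>2 * x = y\<^sup>2" by blast
    then have "x = (y / t)\<^sup>2" using assms by (simp add: power_divide field_simps)
    then show "\<exists>y. x = y\<^sup>2" by blast
  next
    assume "\<exists>y. x = y\<^sup>2"
    then show "\<exists>y. t\<^sup>2 * x = y\<^sup>2" by (metis power_mult_distrib)
  qed
  then show ?thesis using assms by (simp add: quad_char_def)
qed

lemma two_neq_zero_of_odd_card:
  assumes "odd CARD('k::{field,finite})"
  shows "(2::'k) \<noteq> 0"
proof
  assume "(2::'k) = 0"
  then have "of_nat 2 = (0::'k)" by simp
  then have "CHAR('k) dvd 2" by (simp only: of_nat_eq_0_iff_char_dvd)
  moreover have "CHAR('k) \<noteq> 1" by simp
  ultimately have "CHAR('k) = 2"
    using two_is_prime_nat by (metis prime_nat_iff)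
  then show False using CHAR_dvd_CARD[where 'a='k] assms by simp
qed

text \<open>Squaring is two-to-one on the nonzero elements, so exactly half of them are squares.\<close>

lemma card_quad_char_1:
  assumes odd: "odd CARD('k::{field,finite})"
  shows "2 * card {x::'k. quad_char x = 1} + 1 = CARD('k)"
proof -
  let ?Q = "{x::'k. quad_char x = 1}"
  have two: "(2::'k) \<noteq> 0" by (rule two_neq_zero_of_odd_card[OF odd])
  have fibre: "card {x \<in> UNIV - {0}. x\<^sup>2 = s} = 2" if "s \<in> ?Q" for s :: 'k
  proof -
    have "s \<noteq> 0" "\<exists>y. s = y\<^sup>2" using that by (simp_all add: quad_char_eq_1_iff)
    then obtain y where y: "s = y\<^sup>2" "y \<noteq> 0" by auto
    have "{x \<in> UNIV - {0}. x\<^sup>2 = s} = {y, -y}" using y by (auto simp: power2_eq_iff)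
    moreover have "y \<noteq> -y" using y(2) two by (simp add: eq_neg_iff_add_eq_0 flip: mult_2)
    ultimately show ?thesis by simp
  qed
  have "power2 ` (UNIV - {0::'k}) \<subseteq> ?Q" by (auto simp: quad_char_square)
  then have "card (UNIV - {0::'k}) = (\<Sum>s\<in>?Q. card {x \<in> UNIV - {0}. x\<^sup>2 = s})"
    using sum.group[of "UNIV - {0::'k}" ?Q power2 "\<lambda>_. 1::nat"] by simp
  also have "\<dots> = 2 * card ?Q" using fibre by simp
  finally have "card (UNIV - {0::'k}) = 2 * card ?Q" .
  moreover have "CARD('k) = Suc (card (UNIV - {0::'k}))" by (rule card.remove) auto
  ultimately show ?thesis by linarith
qed

lemma card_quad_char_neg_1:
  assumes odd: "odd CARD('k::{field,finite})"
  shows "2 * card {x::'k. quad_char x = -1} + 1 = CARD('k)"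
proof -
  have "(UNIV::'k set) = {x. quad_char x = 1} \<union> {x. quad_char x = -1} \<union> {0}"
    using quad_char_cases by auto
  then have "CARD('k) = card ({x::'k. quad_char x = 1} \<union> {x. quad_char x = -1} \<union> {0})"
    by simp
  also have "\<dots> = card {x::'k. quad_char x = 1} + card {x::'k. quad_char x = -1} + 1"
    by (subst card_Un_disjoint; (subst card_Un_disjoint)?) auto
  finally show ?thesis using card_quad_char_1[OF odd] by linarith
qed

lemma exists_nonsquare:
  assumes odd: "odd CARD('k::{field,finite})"
  obtains n :: "'k::{field,finite}" where "quad_char n = -1"
proof -
  have "card {0, 1 :: 'k} \<le> CARD('k)" by (rule card_mono) auto
  then have "CARD('k) \<ge> 2" by simp
  then have "card {x::'k. quad_char x = -1} \<noteq> 0"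
    using card_quad_char_neg_1[OF odd] by linarith
  then have "{x::'k. quad_char x = -1} \<noteq> {}" by (metis card.empty)
  then show thesis using that by auto
qed

text \<open>The case of two nonsquares is the one with content: multiplication by a nonsquare maps the
  squares injectively to the nonsquares, hence onto them because there are equally many.\<close>

lemma quad_char_mult:
  assumes odd: "odd CARD('k::{field,finite})"
  shows "quad_char (x * y :: 'k) = quad_char x * quad_char y"
proof -
  consider "x = 0 \<or> y = 0" | "quad_char x = 1" | "quad_char y = 1"
    | "quad_char x = -1" "quad_char y = -1"
    using quad_char_cases by blast
  then show ?thesis
  proof cases
    case 1
    then show ?thesis by auto
  next
    case 2
    then show ?thesis
      by (auto simp: quad_char_eq_1_iff quad_char_square_mult quad_char_square)
  next
    case 3
    then show ?thesis
      by (auto simp: quad_char_eq_1_iff quad_char_square_mult quad_char_square mult.commute[of x])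
  next
    case 4
    let ?Q = "{s::'k. quad_char s = 1}" and ?N = "{s::'k. quad_char s = -1}"
    have x: "x \<noteq> 0" using 4 by auto
    have "(*) x ` ?Q \<subseteq> ?N"
      using 4 by (auto simp: quad_char_eq_1_iff quad_char_square_mult mult.commute[of x])
    moreover have "card ((*) x ` ?Q) = card ?N"
      using card_quad_char_1[OF odd] card_quad_char_neg_1[OF odd] x
      by (subst card_image) (auto simp: inj_on_def)
    ultimately have "(*) x ` ?Q = ?N" by (intro card_subset_eq) auto
    then obtain u where "quad_char u = 1" "y = x * u" using 4 by blast
    then have "x * y = x\<^sup>2 * u" by (simp add: power2_eq_square)
    then show ?thesis
      using 4 \<open>quad_char u = 1\<close> by (simp add: quad_char_square_mult[OF x])
  qed
qed

lemma quad_char_eq_imp_square_multiple: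
  assumes odd: "odd CARD('k::{field,finite})"
    and eq: "quad_char (x::'k) = quad_char y"
  obtains t where "t \<noteq> 0" "y = t\<^sup>2 * x"
proof (cases "x = 0")
  case True
  then have "y = 0" using eq by simp
  then show thesis using that[of 1] True by simp
next
  case False
  then have "y \<noteq> 0" using eq by auto
  have "quad_char (x * y) = 1"
    using quad_char_cases[OF False] eq by (auto simp: quad_char_mult[OF odd])
  then obtain u where u: "x * y = u\<^sup>2" by (auto simp: quad_char_eq_1_iff)
  then have "y = (u / x)\<^sup>2 * x" using False by (simp add: field_simps power2_eq_square)
  moreover have "u / x \<noteq> 0" using u False \<open>y \<noteq> 0\<close> by auto
  ultimately show thesis by (rule that[rotated])
qed

lemma quad_char_inverse: "quad_char (inverse (s::'k::field)) = quad_char s"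
proof (cases "s = 0")
  case False
  then have "inverse s = (inverse s)\<^sup>2 * s" by (simp add: power2_eq_square)
  then show ?thesis using quad_char_square_mult[of "inverse s" s] False by simp
qed simp

text \<open>If \<open>m - u\<close> were a square for every nonsquare \<open>u\<close>, then \<open>u \<mapsto> m - u\<close> would map the nonsquares
  injectively to the nonzero squares different from \<open>m\<close>, and there is one square too few for that.\<close>

lemma nonsquares_summing_to_square:
  assumes odd: "odd CARD('k::{field,finite})"
    and m: "quad_char (m::'k) = 1"
  obtains u w :: "'k::{field,finite}" where "quad_char u = -1" "quad_char w = -1" "u + w = m"
proof -
  let ?Q = "{s::'k. quad_char s = 1}" and ?N = "{s::'k. quad_char s = -1}"
  have "\<not> (\<lambda>u. m - u) ` ?N \<subseteq> ?Q - {m}"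
  proof
    assume "(\<lambda>u. m - u) ` ?N \<subseteq> ?Q - {m}"
    then have "card ?N \<le> card (?Q - {m})"
      by (intro card_inj_on_le[of "\<lambda>u. m - u"]) (auto simp: inj_on_def)
    also have "\<dots> < card ?Q" using m by (intro psubset_card_mono) auto
    finally show False
      using card_quad_char_1[OF odd] card_quad_char_neg_1[OF odd] by linarith
  qed
  then obtain u where u: "quad_char u = -1" "\<not> (quad_char (m - u) = 1 \<and> m - u \<noteq> m)" by auto
  have "u \<noteq> 0" using u(1) by auto
  moreover have "m - u \<noteq> 0" using u(1) m by auto
  ultimately have "quad_char (m - u) = -1" using u(2) quad_char_cases[of "m - u"] by auto
  then show thesis using that[of u "m - u"] u(1) by simp
qed

text \<open>Let \<open>n i j\<close> be the number of \<open>s\<close> such that \<open>s\<close> has character \<open>i\<close> and \<open>1 - s\<close> has character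
  \<open>j\<close>. The map \<open>s \<mapsto> 1 - s\<close> shows that \<open>n 1 (-1) = n (-1) 1\<close>. Since
  \<open>1 - 1/s = - (1 - s) / s\<close>, the map \<open>s \<mapsto> 1/s\<close> gives one more relation: it shows that
  \<open>n (-1) 1 = n (-1) (-1)\<close> if \<open>-1\<close> is a square and that \<open>n 1 1 = n 1 (-1)\<close> otherwise. Together with
  the number of squares and of nonsquares, this determines all the \<open>n i j\<close>.\<close>

lemma card_consecutive_squares:
  assumes odd: "odd CARD('k::{field,finite})"
  defines "a \<equiv> card {s::'k. quad_char s = 1 \<and> quad_char (1 - s) = 1}"
  shows "quad_char (-1 :: 'k) = 1 \<Longrightarrow> CARD('k) = 4 * a + 5"
    and "quad_char (-1 :: 'k) = -1 \<Longrightarrow> CARD('k) = 4 * a + 3"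
proof -
  define P where "P i j = {s::'k. quad_char s = i \<and> quad_char (1 - s) = j}" for i j :: int
  have one_minus: "quad_char (1 - s) = 1 \<or> quad_char (1 - s) = -1 \<or> s = 1" for s :: 'k
    using quad_char_cases[of "1 - s"] by auto
  then have "{s::'k. quad_char s = 1} = P 1 1 \<union> P 1 (-1) \<union> {1}"
    unfolding P_def by auto
  then have "card {s::'k. quad_char s = 1} = card (P 1 1 \<union> P 1 (-1) \<union> {1})" by simp
  also have "\<dots> = card (P 1 1) + card (P 1 (-1)) + 1"
    by (subst card_Un_disjoint; (subst card_Un_disjoint)?) (auto simp: P_def)
  finally have squares: "card {s::'k. quad_char s = 1} = card (P 1 1) + card (P 1 (-1)) + 1" .
  have "quad_char (1 - s) = 1 \<or> quad_char (1 - s) = -1" if "quad_char s = -1" for s :: 'k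
    using one_minus[of s] that by auto
  then have "{s::'k. quad_char s = -1} = P (-1) 1 \<union> P (-1) (-1)"
    unfolding P_def by auto
  then have "card {s::'k. quad_char s = -1} = card (P (-1) 1 \<union> P (-1) (-1))" by simp
  also have "\<dots> = card (P (-1) 1) + card (P (-1) (-1))"
    by (subst card_Un_disjoint) (auto simp: P_def)
  finally have nonsquares:
    "card {s::'k. quad_char s = -1} = card (P (-1) 1) + card (P (-1) (-1))" .
  have reflect: "card (P 1 (-1)) = card (P (-1) 1)"
    by (rule bij_betw_same_card[of "\<lambda>s. 1 - s"],
        rule bij_betw_byWitness[where f' = "\<lambda>s. 1 - s"]) (auto simp: P_def)
  have inv: "quad_char (1 - inverse s) = quad_char (-1 :: 'k) * quad_char (1 - s) * quad_char s"
    if "s \<noteq> 0" for s :: 'k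
  proof -
    have "1 - inverse s = (-1) * (1 - s) * inverse s" using that by (simp add: field_simps)
    then show ?thesis by (simp only: quad_char_mult[OF odd] quad_char_inverse)
  qed
  have invert: "card (P i j) = card (P i (quad_char (-1 :: 'k) * j * i))"
    if "i \<noteq> 0" for i j
  proof -
    \<comment> \<open>The target character is an involution of \<open>j\<close>, because all the factors are signs.\<close>
    have sq: "quad_char (-1 :: 'k) * (quad_char (-1 :: 'k) * j * i) * i = j" 
      if "quad_char s = i" for s :: 'k
      using quad_char_cases[of "-1 :: 'k"] quad_char_cases[of s] that \<open>i \<noteq> 0\<close> by auto
    have "inverse ` P i j = P i (quad_char (-1 :: 'k) * j * i)"
    proof (intro equalityI subsetI)
      fix s :: 'k assume "s \<in> inverse ` P i j"
      then show "s \<in> P i (quad_char (-1 :: 'k) * j * i)"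
        using inv \<open>i \<noteq> 0\<close> by (auto simp: P_def quad_char_inverse)
    next
      fix s :: 'k assume s: "s \<in> P i (quad_char (-1 :: 'k) * j * i)"
      then have "s \<noteq> 0" using \<open>i \<noteq> 0\<close> by (auto simp: P_def)
      then have "inverse s \<in> P i j"
        using s sq[of s] by (auto simp: P_def quad_char_inverse inv)
      then show "s \<in> inverse ` P i j" by (metis imageI inverse_inverse_eq)
    qed
    then show ?thesis by (metis card_image inj_on_inverseI inverse_inverse_eq)
  qed
  have a: "a = card (P 1 1)" by (simp add: a_def P_def)
  note q = card_quad_char_1[OF odd] card_quad_char_neg_1[OF odd] squares nonsquares reflect a
  show "CARD('k) = 4 * a + 5" if "quad_char (-1 :: 'k) = 1"
    using q invert[of "-1" 1, unfolded that, simplified] by linarith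
  show "CARD('k) = 4 * a + 3" if "quad_char (-1 :: 'k) = -1"
    using q invert[of 1 1, unfolded that, simplified] by linarith
qed

section \<open>Orbitals of a transitive action\<close>

text \<open>The elements of the group below are cosets of matrices, and the action is a total function with
  arbitrary values off the set \<open>X\<close> of hyperbolic lines. The group axioms are therefore stated for
  the maps that the elements of the carrier induce on \<open>X\<close>: they form a transitive permutation
  group.\<close>

locale transitive_maps =
  fixes G :: "('g, 'm) monoid_scheme" and X :: "'a set" and \<phi> :: "'g \<Rightarrow> 'a \<Rightarrow> 'a"
  assumes finite: "finite X" and nonempty: "X \<noteq> {}"
    and closed: "\<And>g x. g \<in> carrier G \<Longrightarrow> x \<in> X \<Longrightarrow> \<phi> g x \<in> X"
    and identity: "\<exists>e\<in>carrier G. \<forall>x\<in>X. \<phi> e x = x"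
    and compose: "\<And>g h. g \<in> carrier G \<Longrightarrow> h \<in> carrier G
      \<Longrightarrow> \<exists>k\<in>carrier G. \<forall>x\<in>X. \<phi> k x = \<phi> g (\<phi> h x)"
    and invert: "\<And>g. g \<in> carrier G \<Longrightarrow> \<exists>h\<in>carrier G. \<forall>x\<in>X. \<phi> h (\<phi> g x) = x"
    and transitive: "\<And>x y. x \<in> X \<Longrightarrow> y \<in> X \<Longrightarrow> \<exists>g\<in>carrier G. \<phi> g x = y"
begin

definition orbital :: "'a \<Rightarrow> 'a \<Rightarrow> ('a \<times> 'a) set" where
  "orbital x y = {(\<phi> g x, \<phi> g y) | g. g \<in> carrier G}"

lemma orbital_scheme_eq: "orbital_scheme G X \<phi> = {orbital x y | x y. x \<in> X \<and> y \<in> X}"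
  by (auto simp: orbital_scheme_def orbits_def orbit_def orbital_def)

lemma orbital_refl: "x \<in> X \<Longrightarrow> y \<in> X \<Longrightarrow> (x, y) \<in> orbital x y"
  using identity by (force simp: orbital_def)

lemma orbital_sym:
  assumes "x \<in> X" "y \<in> X" "(u, v) \<in> orbital x y"
  shows "(x, y) \<in> orbital u v"
proof -
  obtain g where g: "g \<in> carrier G" "u = \<phi> g x" "v = \<phi> g y"
    using assms by (auto simp: orbital_def)
  obtain h where "h \<in> carrier G" "\<forall>x\<in>X. \<phi> h (\<phi> g x) = x" using invert[OF g(1)] by blast
  then show ?thesis using g assms by (force simp: orbital_def)
qed

lemma orbital_mono:
  assumes "x \<in> X" "y \<in> X" "(u, v) \<in> orbital x y"
  shows "orbital u v \<subseteq> orbital x y"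
proof
  fix p assume "p \<in> orbital u v"
  then obtain h where h: "h \<in> carrier G" "p = (\<phi> h u, \<phi> h v)" by (auto simp: orbital_def)
  obtain g where g: "g \<in> carrier G" "u = \<phi> g x" "v = \<phi> g y"
    using assms by (auto simp: orbital_def)
  obtain k where "k \<in> carrier G" "\<forall>x\<in>X. \<phi> k x = \<phi> h (\<phi> g x)" using compose h(1) g(1) by blast
  then show "p \<in> orbital x y" using h g assms by (force simp: orbital_def)
qed

lemma orbital_subset: "x \<in> X \<Longrightarrow> y \<in> X \<Longrightarrow> orbital x y \<subseteq> X \<times> X"
  using closed by (auto simp: orbital_def)

lemma orbital_eqI:
  assumes "x \<in> X" "y \<in> X" "(u, v) \<in> orbital x y"
  shows "orbital u v = orbital x y"
proof -
  have "u \<in> X" "v \<in> X" using orbital_subset[OF assms(1,2)] assms(3) by auto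
  then show ?thesis using orbital_mono orbital_sym assms by (meson equalityI)
qed

lemma orbital_eq_iff:
  assumes "x \<in> X" "y \<in> X" "u \<in> X" "v \<in> X"
  shows "orbital x y = orbital u v \<longleftrightarrow> (u, v) \<in> orbital x y"
  using assms orbital_eqI orbital_refl by metis

lemma mem_orbital_scheme_eq:
  assumes "R \<in> orbital_scheme G X \<phi>" "(u, v) \<in> R"
  shows "u \<in> X \<and> v \<in> X \<and> R = orbital u v"
proof -
  obtain x y where "R = orbital x y" "x \<in> X" "y \<in> X"
    using assms by (auto simp: orbital_scheme_eq)
  then show ?thesis using assms orbital_eqI orbital_subset by blast
qed

lemma orbital_invariant:
  assumes "R \<in> orbital_scheme G X \<phi>" "(u, v) \<in> R" "g \<in> carrier G"
  shows "(\<phi> g u, \<phi> g v) \<in> R"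
  using mem_orbital_scheme_eq[OF assms(1,2)] assms(3) by (auto simp: orbital_def)

lemma inj_on_action: "g \<in> carrier G \<Longrightarrow> inj_on (\<phi> g) X"
  by (metis inj_onI invert)

text \<open>An element of \<open>G\<close> that maps one pair of an orbital to another maps the points counted by an
  intersection number at the first pair injectively to those counted at the second.\<close>

lemma intersection_number_le:
  assumes "R \<in> orbital_scheme G X \<phi>" "T \<in> orbital_scheme G X \<phi>"
    and "x \<in> X" "y \<in> X" "(u, v) \<in> orbital x y"
  shows "card {z \<in> X. (x, z) \<in> R \<and> (z, y) \<in> T} \<le> card {z \<in> X. (u, z) \<in> R \<and> (z, v) \<in> T}"
proof -
  obtain g where g: "g \<in> carrier G" "u = \<phi> g x" "v = \<phi> g y"
    using assms by (auto simp: orbital_def)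
  show ?thesis
  proof (rule card_inj_on_le)
    show "inj_on (\<phi> g) {z \<in> X. (x, z) \<in> R \<and> (z, y) \<in> T}"
      using inj_on_action[OF g(1)] by (rule inj_on_subset) auto
    show "\<phi> g ` {z \<in> X. (x, z) \<in> R \<and> (z, y) \<in> T} \<subseteq> {z \<in> X. (u, z) \<in> R \<and> (z, v) \<in> T}"
      using orbital_invariant assms(1,2) g closed by auto
    show "finite {z \<in> X. (u, z) \<in> R \<and> (z, v) \<in> T}" using finite by auto
  qed
qed

lemma diagonal_eq_orbital:
  assumes "x \<in> X"
  shows "Id_on X = orbital x x"
  using assms closed transitive by (force simp: orbital_def Id_on_def)

lemma diagonal_mem_orbital_scheme: "Id_on X \<in> orbital_scheme G X \<phi>"
  using nonempty diagonal_eq_orbital unfolding orbital_scheme_eq by blast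

theorem association_scheme_orbital_scheme: "association_scheme X (orbital_scheme G X \<phi>)"
  unfolding association_scheme_def
proof (intro conjI ballI)
  let ?S = "orbital_scheme G X \<phi>"
  show "finite X" by (rule finite)
  show "partition_on (X \<times> X) ?S"
  proof (rule partition_onI)
    show "\<Union>?S = X \<times> X"
    proof
      show "\<Union>?S \<subseteq> X \<times> X" using mem_orbital_scheme_eq by auto
      show "X \<times> X \<subseteq> \<Union>?S"
        using orbital_refl unfolding orbital_scheme_eq by blast
    qed
    show "{} \<notin> ?S" using orbital_refl unfolding orbital_scheme_eq by blast
    show "disjnt R T" if "R \<in> ?S" "T \<in> ?S" "R \<noteq> T" for R T
      unfolding disjnt_def
    proof (rule ccontr)
      assume "R \<inter> T \<noteq> {}"
      then obtain u v where "(u, v) \<in> R" "(u, v) \<in> T" by auto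
      then show False using mem_orbital_scheme_eq that by blast
    qed
  qed
  show "Id_on X \<in> ?S" by (rule diagonal_mem_orbital_scheme)
  show "converse R \<in> ?S" if R: "R \<in> ?S" for R
  proof -
    obtain x y where "R = orbital x y" "x \<in> X" "y \<in> X" using R by (auto simp: orbital_scheme_eq)
    moreover from this have "converse R = orbital y x" by (auto simp: orbital_def)
    ultimately show ?thesis by (auto simp: orbital_scheme_eq)
  qed
  fix R T U assume S: "R \<in> ?S" "T \<in> ?S" "U \<in> ?S"
  then obtain x y where U: "U = orbital x y" "x \<in> X" "y \<in> X" by (auto simp: orbital_scheme_eq)
  have "card {z \<in> X. (u, z) \<in> R \<and> (z, v) \<in> T} = card {z \<in> X. (x, z) \<in> R \<and> (z, y) \<in> T}"
    if uv: "(u, v) \<in> U" for u v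
  proof (rule antisym)
    have "u \<in> X" "v \<in> X" using uv orbital_subset U by auto
    then show "card {z \<in> X. (u, z) \<in> R \<and> (z, v) \<in> T} \<le> card {z \<in> X. (x, z) \<in> R \<and> (z, y) \<in> T}"
      using S(1,2) U uv orbital_sym by (intro intersection_number_le) auto
    show "card {z \<in> X. (x, z) \<in> R \<and> (z, y) \<in> T} \<le> card {z \<in> X. (u, z) \<in> R \<and> (z, v) \<in> T}"
      using S(1,2) U uv by (intro intersection_number_le) auto
  qed
  then show "\<exists>p. \<forall>(x, y)\<in>U. card {z \<in> X. (x, z) \<in> R \<and> (z, y) \<in> T} = p" by blast
qed

lemma num_classes_orbital_scheme:
  "num_classes X (orbital_scheme G X \<phi>) = card (orbital_scheme G X \<phi>) - 1"
  using diagonal_mem_orbital_scheme by (simp add: num_classes_def)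

text \<open>By transitivity, every orbital contains a pair whose first entry is a given base point.\<close>

lemma orbital_scheme_eq_image:
  assumes x: "x \<in> X"
  shows "orbital_scheme G X \<phi> = orbital x ` X"
proof (intro equalityI subsetI)
  fix R assume "R \<in> orbital_scheme G X \<phi>"
  then obtain u v where R: "R = orbital u v" "u \<in> X" "v \<in> X" by (auto simp: orbital_scheme_eq)
  obtain g where g: "g \<in> carrier G" "\<phi> g u = x" using transitive R x by blast
  then have "(x, \<phi> g v) \<in> orbital u v" by (auto simp: orbital_def)
  then have "R = orbital x (\<phi> g v)" using orbital_eqI R by metis
  then show "R \<in> orbital x ` X" using closed g R by auto
next
  fix R assume "R \<in> orbital x ` X"
  then show "R \<in> orbital_scheme G X \<phi>" using x by (auto simp: orbital_scheme_eq)
qed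

lemma symmetric_scheme_imp_reversal:
  assumes "symmetric_scheme (orbital_scheme G X \<phi>)" "x \<in> X" "y \<in> X"
  shows "\<exists>g\<in>carrier G. \<phi> g x = y \<and> \<phi> g y = x"
proof -
  have "sym (orbital x y)"
    using assms by (auto simp: symmetric_scheme_def orbital_scheme_eq)
  then have "(y, x) \<in> orbital x y" using orbital_refl assms by (meson symE)
  then show ?thesis by (auto simp: orbital_def)
qed

end

section \<open>The symmetric square representation\<close>

abbreviation mat2 :: "'k::field \<Rightarrow> 'k \<Rightarrow> 'k \<Rightarrow> 'k \<Rightarrow> 'k ^ 2 ^ 2" where
  "mat2 a b c d \<equiv> vector [vector [a, b], vector [c, d]]"

definition SL2 :: "('k::field ^ 2 ^ 2) set" where
  "SL2 = {A. det A = 1}"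

lemma mat2_mem_SL2: "mat2 a b c d \<in> SL2 \<longleftrightarrow> a * d - b * c = 1"
  by (simp add: SL2_def det_2)

lemma mat_1_mem_SL2: "mat 1 \<in> SL2"
  by (simp add: SL2_def)

lemma SL2_mult: "A \<in> SL2 \<Longrightarrow> B \<in> SL2 \<Longrightarrow> A ** B \<in> SL2"
  by (simp add: SL2_def det_mul)

lemma SL2_inverse:
  assumes "A \<in> SL2"
  obtains B where "B \<in> SL2" "B ** A = mat 1"
proof
  let ?B = "mat2 (A$2$2) (- A$1$2) (- A$2$1) (A$1$1)"
  have det: "A$1$1 * A$2$2 - A$1$2 * A$2$1 = 1" using assms by (simp add: SL2_def det_2)
  then show "?B \<in> SL2" by (simp add: mat2_mem_SL2 algebra_simps)
  show "?B ** A = mat 1"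
    using det by (simp add: vec_eq_iff forall_2 matrix_matrix_mult_def sum_2 mat_def algebra_simps)
qed

lemma rho_mat_vec:
  "rho_mat A *v v = vector
     [(A$1$1)\<^sup>2 * v$1 + 2 * A$1$1 * A$1$2 * v$2 + (A$1$2)\<^sup>2 * v$3,
      A$1$1 * A$2$1 * v$1 + (A$1$1 * A$2$2 + A$1$2 * A$2$1) * v$2 + A$1$2 * A$2$2 * v$3,
      (A$2$1)\<^sup>2 * v$1 + 2 * A$2$1 * A$2$2 * v$2 + (A$2$2)\<^sup>2 * v$3]"
  by (simp add: vec_eq_iff forall_3 matrix_vector_mult_def sum_3 rho_mat_def Let_def)

lemma vec3_eq_iff: "(v::'a^3) = w \<longleftrightarrow> v$1 = w$1 \<and> v$2 = w$2 \<and> v$3 = w$3"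
  by (simp add: vec_eq_iff forall_3)

lemma rho_mat_mult: "rho_mat (A ** B) = rho_mat A ** rho_mat B"
  by (simp add: vec_eq_iff forall_3 matrix_matrix_mult_def sum_2 sum_3 rho_mat_def Let_def power2_eq_square
      algebra_simps)

lemma rho_mat_one: "rho_mat (mat 1) = mat 1"
  by (simp add: vec_eq_iff forall_3 rho_mat_def Let_def mat_def)

lemma mat_mult_nth: "(mat c ** M) $ i $ j = c * (M :: 'k::field ^ 'n ^ 'm) $ i $ j"
  by (simp add: matrix_matrix_mult_def mat_def if_distrib if_distribR cong: if_cong)

lemma mat_mult_vec: "(mat c ** M) *v x = c *s (M *v (x :: 'k::field ^ 'n))"
  by (simp add: vec_eq_iff matrix_vector_mult_def mat_mult_nth sum_distrib_left mult.assoc)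

lemma rho_mat_scale: "rho_mat (mat c ** A) = mat (c\<^sup>2) ** rho_mat A"
  by (simp add: vec_eq_iff forall_3 mat_mult_nth rho_mat_def Let_def power2_eq_square algebra_simps)

lemma rho_mat_inverse:
  assumes "B ** A = mat 1"
  shows "rho_mat B *v (rho_mat A *v v) = v"
  using assms by (simp add: matrix_vector_mul_assoc rho_mat_mult[symmetric] rho_mat_one)

lemma rho_mat_SL2_inverse:
  assumes "A \<in> SL2"
  obtains B where "B \<in> SL2" "\<And>v. rho_mat B *v (rho_mat A *v v) = v"
    "\<And>v. rho_mat A *v (rho_mat B *v v) = v"
proof -
  obtain B where "B \<in> SL2" "B ** A = mat 1" using SL2_inverse[OF assms] .
  then show thesis
    using that rho_mat_inverse matrix_left_right_inverse by metis
qed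

section \<open>The projective group acts through matrices of determinant one\<close>

text \<open>Scalar factors change neither a projective class nor the image of a subspace. So the maps
  induced by the group on lines are exactly those induced by the symmetric squares of the matrices of
  determinant one.\<close>

lemma proj_class_eq: "proj_class A = {mat c ** A | c. c \<noteq> 0}"
  by (auto simp: proj_class_def r_coset_def scalar_matrices_def GL_def)

lemma proj_class_scale:
  assumes "c \<noteq> 0"
  shows "proj_class (mat c ** A) = proj_class A"
proof -
  have mm: "mat b ** (mat c ** A) = mat (b * c) ** A" for b
    by (simp add: vec_eq_iff mat_mult_nth mult.assoc)
  show ?thesis unfolding proj_class_eq mm
  proof (intro equalityI subsetI)
    fix M assume "M \<in> {mat b ** A | b. b \<noteq> 0}"
    then obtain b where "M = mat b ** A" "b \<noteq> 0" by blast
    then have "M = mat (b / c * c) ** A" "b / c \<noteq> 0" using assms by auto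
    then show "M \<in> {mat (b * c) ** A | b. b \<noteq> 0}" by blast
  qed (use assms in auto)
qed

lemma mem_proj_class: "A \<in> proj_class A"
proof -
  have "A = mat 1 ** A" by simp
  then show ?thesis unfolding proj_class_eq by (metis (mono_tags, lifting) mem_Collect_eq one_neq_zero)
qed

lemma the_elem_image_proj_class:
  assumes "\<And>c. c \<noteq> 0 \<Longrightarrow> f (mat c ** A) = f A"
  shows "the_elem (f ` proj_class A) = f A"
proof -
  have "f M = f A" if "M \<in> proj_class A" for M
    using that assms by (auto simp: proj_class_eq)
  then have "f ` proj_class A = {f A}" using mem_proj_class by blast
  then show ?thesis by simp
qed

lemma rho_proj_class: "rho (proj_class A) = proj_class (rho_mat A)"
  unfolding rho_def by (rule the_elem_image_proj_class) (simp add: rho_mat_scale proj_class_scale)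

lemma carrier_POmega3: "carrier POmega3 = (\<lambda>A. proj_class (rho_mat A)) ` SL2"
  by (simp add: POmega3_def PSL_def SL2_def image_image rho_proj_class)

lemma point_action_proj_class:
  assumes "vec.subspace P"
  shows "point_action (proj_class M) P = (*v) M ` P"
  unfolding point_action_def
proof (rule the_elem_image_proj_class)
  fix c :: 'a assume c: "c \<noteq> 0"
  have "(*s) c ` P = P"
  proof
    show "(*s) c ` P \<subseteq> P" using assms by (auto intro: vec.subspace_scale)
    show "P \<subseteq> (*s) c ` P"
    proof
      fix x assume "x \<in> P"
      then have "inverse c *s x \<in> P" using assms by (intro vec.subspace_scale)
      then show "x \<in> (*s) c ` P" using c by (intro image_eqI[of _ _ "inverse c *s x"]) auto
    qed
  qed
  moreover have "(*v) (mat c ** M) ` P = (*v) M ` ((*s) c ` P)"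
    by (simp add: image_image mat_mult_vec vec.scale)
  ultimately show "(*v) (mat c ** M) ` P = (*v) M ` P" by simp
qed

definition point_image :: "'k::field ^ 2 ^ 2 \<Rightarrow> ('k ^ 3) set \<Rightarrow> ('k ^ 3) set" where
  "point_image A P = (*v) (rho_mat A) ` P"

definition line_image :: "'k::field ^ 2 ^ 2 \<Rightarrow> ('k ^ 3) set set \<Rightarrow> ('k ^ 3) set set" where
  "line_image A l = point_image A ` l"

lemma line_action_proj_class:
  assumes "l \<subseteq> proj_points"
  shows "line_action (proj_class (rho_mat A)) l = line_image A l"
  unfolding line_action_def line_image_def point_image_def
  using assms by (intro image_cong refl point_action_proj_class) (auto simp: proj_points_def)

lemma line_image_mult: "line_image (A ** B) l = line_image A (line_image B l)"
  by (simp add: line_image_def point_image_def image_image rho_mat_mult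
      matrix_vector_mul_assoc[symmetric])

lemma line_image_one: "line_image (mat 1) l = l"
  by (simp add: line_image_def point_image_def rho_mat_one)

lemma line_image_inverse: "B ** A = mat 1 \<Longrightarrow> line_image B (line_image A l) = l"
  by (simp add: line_image_mult[symmetric] line_image_one)

section \<open>Hyperbolic lines as polars of vectors of norm one\<close>

lemma proj_points_eq: "proj_points = {vec.span {x} | x. x \<noteq> 0}"
proof (intro equalityI subsetI)
  fix P :: "('a ^ 3) set" assume "P \<in> proj_points"
  then have P: "vec.subspace P" "vec.dim P = 1" by (auto simp: proj_points_def)
  obtain B where B: "B \<subseteq> P" "vec.independent B" "P \<subseteq> vec.span B" "card B = vec.dim P"
    by (rule vec.basis_exists)
  then obtain x where x: "B = {x}" using P by (auto simp: card_1_singleton_iff)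
  then have "x \<noteq> 0" using B(2) vec.dependent_zero by blast
  moreover have "P = vec.span {x}" using B x P by (simp add: vec.span_minimal subset_antisym)
  ultimately show "P \<in> {vec.span {x} | x. x \<noteq> 0}" by blast
next
  fix P :: "('a ^ 3) set" assume "P \<in> {vec.span {x} | x. x \<noteq> 0}"
  then obtain x where x: "P = vec.span {x}" "x \<noteq> 0" by blast
  then have "vec.dim P = 1"
    using vec.dim_span_eq_card_independent[of "{x}"] by simp
  then show "P \<in> proj_points" using x by (simp add: proj_points_def)
qed

lemma point_image_span: "point_image A (vec.span {x}) = vec.span {rho_mat A *v x}"
  using vec.span_image[of "rho_mat A" "{x}"] by (simp add: point_image_def)

lemma point_image_inverse:
  "B ** A = mat 1 \<Longrightarrow> point_image B (point_image A P) = P"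
  by (simp add: point_image_def image_image rho_mat_inverse)

lemma inj_point_image:
  assumes "A \<in> SL2"
  shows "inj (point_image A)"
proof -
  obtain B where "B \<in> SL2" "B ** A = mat 1" using SL2_inverse[OF assms] .
  then show ?thesis using point_image_inverse by (metis injI)
qed

lemma inj_rho_mat:
  assumes "A \<in> SL2"
  shows "inj ((*v) (rho_mat A))"
  by (rule rho_mat_SL2_inverse[OF assms]) (metis injI)

lemma point_image_proj_points:
  assumes "A \<in> SL2" "P \<in> proj_points"
  shows "point_image A P \<in> proj_points"
proof -
  obtain x where x: "x \<noteq> 0" "P = vec.span {x}" using assms by (auto simp: proj_points_eq)
  have "rho_mat A *v x \<noteq> 0"
    using x inj_rho_mat[OF assms(1)] by (metis injD matrix_vector_mult_0_right)
  then show ?thesis using x by (auto simp: proj_points_eq point_image_span)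
qed

text \<open>An invertible matrix permutes the points, so a point inside the image of \<open>W\<close> is the image of
  a point inside \<open>W\<close>.\<close>

lemma line_image_points_in:
  assumes "A \<in> SL2"
  shows "line_image A {P \<in> proj_points. P \<subseteq> W} = {P \<in> proj_points. P \<subseteq> (*v) (rho_mat A) ` W}"
proof -
  obtain B where B: "B \<in> SL2" "B ** A = mat 1" using SL2_inverse[OF assms] .
  then have AB: "A ** B = mat 1" using matrix_left_right_inverse by blast
  show ?thesis
  proof (intro equalityI subsetI)
    fix P assume "P \<in> line_image A {P \<in> proj_points. P \<subseteq> W}"
    then show "P \<in> {P \<in> proj_points. P \<subseteq> (*v) (rho_mat A) ` W}"
      using point_image_proj_points[OF assms] by (auto simp: line_image_def point_image_def)
  next
    fix P assume P: "P \<in> {P \<in> proj_points. P \<subseteq> (*v) (rho_mat A) ` W}"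
    then have "point_image B P \<in> {P \<in> proj_points. P \<subseteq> W}"
      using point_image_proj_points[OF B(1)] rho_mat_inverse[OF B(2)]
      by (auto simp: point_image_def)
    then show "P \<in> line_image A {P \<in> proj_points. P \<subseteq> W}"
      unfolding line_image_def
      by (intro image_eqI[where x = "point_image B P"]) (simp_all add: point_image_inverse[OF AB])
  qed
qed

text \<open>The form whose singular points make up the conic, and its polar form. The matrix
  \<open>rho_mat A\<close> scales \<open>qform\<close> by \<open>(det A)\<^sup>2\<close>, so \<open>SL2\<close> acts by isometries.
  Identifying \<open>v = (y, x, z)\<close> with the traceless matrix with rows \<open>(x, -y)\<close> and \<open>(z, -x)\<close>, this is
  the conjugation action, and \<open>qform v = 1\<close> says that this matrix has square one.\<close>

definition qform :: "'k::field ^ 3 \<Rightarrow> 'k" where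
  "qform v = (v$2)\<^sup>2 - v$1 * v$3"

definition polar :: "'k::field ^ 3 \<Rightarrow> 'k ^ 3 \<Rightarrow> 'k" where
  "polar v w = 2 * v$2 * w$2 - v$1 * w$3 - v$3 * w$1"

definition polar_line :: "'k::field ^ 3 \<Rightarrow> ('k ^ 3) set set" where
  "polar_line v = {P \<in> proj_points. P \<subseteq> {x. polar v x = 0}}"

lemma qform_rho: 
  assumes "A \<in> SL2"
  shows "qform (rho_mat A *v v) = qform v"
proof -
  have "qform (rho_mat A *v v) = (det A)\<^sup>2 * qform v"
    by (simp add: qform_def rho_mat_vec det_2 power2_eq_square algebra_simps)
  then show ?thesis using assms by (simp add: SL2_def)
qed

lemma polar_rho:
  assumes "A \<in> SL2"
  shows "polar (rho_mat A *v v) (rho_mat A *v w) = polar v w"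
proof -
  have "polar (rho_mat A *v v) (rho_mat A *v w) = (det A)\<^sup>2 * polar v w"
    by (simp add: polar_def rho_mat_vec det_2 power2_eq_square algebra_simps)
  then show ?thesis using assms by (simp add: SL2_def)
qed

lemma line_image_polar_line:
  assumes A: "A \<in> SL2"
  shows "line_image A (polar_line v) = polar_line (rho_mat A *v v)"
proof -
  obtain B where B: "B \<in> SL2" "\<And>v. rho_mat B *v (rho_mat A *v v) = v"
    "\<And>v. rho_mat A *v (rho_mat B *v v) = v" by (rule rho_mat_SL2_inverse[OF A]) blast
  have "(*v) (rho_mat A) ` {x. polar v x = 0} = {x. polar (rho_mat A *v v) x = 0}"
  proof (intro equalityI subsetI)
    fix x assume "x \<in> {x. polar (rho_mat A *v v) x = 0}"
    then have "polar v (rho_mat B *v x) = 0"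
      using polar_rho[OF A, of v "rho_mat B *v x"] by (simp add: B(3))
    then show "x \<in> (*v) (rho_mat A) ` {x. polar v x = 0}"
      by (intro image_eqI[where x = "rho_mat B *v x"]) (simp_all add: B(3))
  qed (auto simp: polar_rho[OF A])
  then show ?thesis unfolding polar_line_def line_image_points_in[OF A] by simp
qed

abbreviation e0 :: "'k::field ^ 3" where "e0 \<equiv> vector [1, 0, 0]"
abbreviation e1 :: "'k::field ^ 3" where "e1 \<equiv> vector [0, 1, 0]"
abbreviation e2 :: "'k::field ^ 3" where "e2 \<equiv> vector [0, 0, 1]"

lemma rho_e1: "rho_mat A *v e1 = vector
    [2 * A$1$1 * A$1$2, A$1$1 * A$2$2 + A$1$2 * A$2$1, 2 * A$2$1 * A$2$2]"
  by (simp add: rho_mat_vec)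

lemma qform_e1: "qform e1 = 1"
  by (simp add: qform_def)

text \<open>Together with \<open>det A = 1\<close>, the equation \<open>rho_mat A *v e1 = v\<close> prescribes the products \<open>ab\<close>,
  \<open>ad\<close>, \<open>bc\<close> and \<open>cd\<close> of the entries of \<open>A\<close>. They are compatible because
  \<open>(ab)(cd) = (ad)(bc)\<close> is the condition \<open>qform v = 1\<close>. One can take \<open>a = 1\<close> unless the middle
  coordinate of \<open>v\<close> is \<open>-1\<close>, which forces \<open>ad = 0\<close>.\<close>

lemma exists_rho_e1:
  fixes v :: "'k::field ^ 3"
  assumes two: "(2::'k) \<noteq> 0" and v: "qform v = 1"
  obtains A where "A \<in> SL2" "rho_mat A *v e1 = v"
proof -
  define x y z where xyz: "x = v$2" "y = v$1" "z = v$3"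
  have q: "y * z = x\<^sup>2 - 1" using v by (simp add: qform_def xyz algebra_simps)
  note witness = that
  have sol: thesis if "a * d - b * c = 1" "2 * a * b = y" "a * d + b * c = x" "2 * c * d = z"
    for a b c d
    using that(1) that(2-4) xyz
    by (intro witness[of "mat2 a b c d"]) (auto simp: mat2_mem_SL2 rho_e1 vec3_eq_iff)
  show thesis
  proof (cases "x = -1")
    case False
    then have x: "1 + x \<noteq> 0" by (metis add.commute eq_neg_iff_add_eq_0)
    have "y * z = (x - 1) * (1 + x)" using q by (simp add: power2_eq_square algebra_simps)
    then have "y / 2 * (z / (1 + x)) = (x - 1) * (1 + x) / (2 * (1 + x))"
      by (simp only: times_divide_times_eq)
    then have bc: "y / 2 * (z / (1 + x)) = (x - 1) / 2"
      by (simp only: nonzero_mult_divide_mult_cancel_right[OF x])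
    show ?thesis
    proof (rule sol)
      show "1 * ((1 + x) / 2) - y / 2 * (z / (1 + x)) = 1"
        unfolding bc using two by (simp add: diff_divide_distrib[symmetric])
      show "1 * ((1 + x) / 2) + y / 2 * (z / (1 + x)) = x"
        unfolding bc using two by (simp add: add_divide_distrib[symmetric])
    qed (use x two in simp_all)
  next
    case True
    then have "y = 0 \<or> z = 0" using q by simp
    then show ?thesis
    proof
      assume "y = 0"
      then show ?thesis using True two by (intro sol[of 0 "- z / 2" 1 "-1"]) auto
    next
      assume "z = 0"
      then show ?thesis using True two by (intro sol[of "y / 2" 0 1 "-1"]) auto
    qed
  qed
qed

text \<open>The conic in homogeneous parameters. The matrix \<open>rho_mat A\<close> is the symmetric square of \<open>A\<close>,
  so it acts on the conic as \<open>A\<close> acts on the parameters \<open>(s, t)\<close> of the projective line.\<close>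

definition veronese :: "'k::field \<Rightarrow> 'k \<Rightarrow> 'k ^ 3" where
  "veronese s t = vector [s\<^sup>2, s * t, t\<^sup>2]"

lemma veronese_scale: "veronese (c * s) (c * t) = c\<^sup>2 *s veronese s t"
  by (simp add: veronese_def vec3_eq_iff power2_eq_square)

lemma rho_veronese:
  "rho_mat A *v veronese s t = veronese (A$1$1 * s + A$1$2 * t) (A$2$1 * s + A$2$2 * t)"
  by (simp add: rho_mat_vec veronese_def power2_eq_square algebra_simps)

lemma vec_span_scale:
  assumes "(c::'k::field) \<noteq> 0"
  shows "vec.span {c *s x} = vec.span {x :: 'k ^ 'n}"
  using vec.span_image_scale[of "{x}" "\<lambda>_. c"] assms by simp

lemma span_veronese_scale:
  "c \<noteq> 0 \<Longrightarrow> vec.span {veronese (c * s) (c * t)} = vec.span {veronese s t}"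
  by (simp add: veronese_scale vec_span_scale)

lemma conic_eq: "conic = {vec.span {veronese s t} | s t. s \<noteq> 0 \<or> t \<noteq> 0}"
proof (intro equalityI subsetI)
  fix P :: "('a ^ 3) set" assume "P \<in> conic"
  then consider \<xi> where "P = vec.span {veronese \<xi> 1}" | "P = vec.span {veronese 1 0}"
    by (auto simp: conic_def proj_point_def veronese_def)
  then show "P \<in> {vec.span {veronese s t} | s t. s \<noteq> 0 \<or> t \<noteq> 0}"
    by cases force+
next
  fix P :: "('a ^ 3) set" assume "P \<in> {vec.span {veronese s t} | s t. s \<noteq> 0 \<or> t \<noteq> 0}"
  then obtain s t where P: "P = vec.span {veronese s t}" "s \<noteq> 0 \<or> t \<noteq> 0" by blast
  show "P \<in> conic"
  proof (cases "t = 0")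
    case True
    then have "P = vec.span {veronese 1 0}" using P span_veronese_scale[of s 1 0] by simp
    then show ?thesis by (simp add: conic_def proj_point_def veronese_def)
  next
    case False
    then have "P = vec.span {veronese (s / t) 1}"
      using P span_veronese_scale[of t "s / t" 1] by simp
    then show ?thesis by (auto simp: conic_def proj_point_def veronese_def)
  qed
qed

lemma span_veronese_eq_of_proportional:
  assumes "s \<noteq> 0 \<or> t \<noteq> 0" "s' \<noteq> 0 \<or> t' \<noteq> 0" "s * t' = s' * t"
  shows "vec.span {veronese s t} = vec.span {veronese s' t'}"
proof -
  obtain c where c: "c \<noteq> 0" "s' = c * s" "t' = c * t"
  proof (cases "s = 0")
    case True
    then show thesis using assms by (intro that[of "t' / t"]) auto
  next
    case False
    then have "s' \<noteq> 0" using assms by auto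
    then show thesis using False assms by (intro that[of "s' / s"]) (auto simp: field_simps)
  qed
  then show ?thesis by (simp add: span_veronese_scale)
qed

lemma point_image_conic_subset:
  assumes "A \<in> SL2"
  shows "point_image A ` conic \<subseteq> conic"
proof
  fix P assume "P \<in> point_image A ` conic"
  then obtain s t where st: "s \<noteq> 0 \<or> t \<noteq> 0" and "P = point_image A (vec.span {veronese s t})"
    unfolding conic_eq by blast
  then have P: "P = vec.span {veronese (A$1$1 * s + A$1$2 * t) (A$2$1 * s + A$2$2 * t)}"
    by (simp add: point_image_span rho_veronese)
  have det: "A$1$1 * A$2$2 - A$1$2 * A$2$1 = 1" using assms by (simp add: SL2_def det_2)
  have s: "A$2$2 * (A$1$1 * s + A$1$2 * t) - A$1$2 * (A$2$1 * s + A$2$2 * t)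
      = (A$1$1 * A$2$2 - A$1$2 * A$2$1) * s"
    by (simp add: algebra_simps)
  have t: "A$1$1 * (A$2$1 * s + A$2$2 * t) - A$2$1 * (A$1$1 * s + A$1$2 * t)
      = (A$1$1 * A$2$2 - A$1$2 * A$2$1) * t"
    by (simp add: algebra_simps)
  have "A$1$1 * s + A$1$2 * t \<noteq> 0 \<or> A$2$1 * s + A$2$2 * t \<noteq> 0"
    using st s t unfolding det by auto
  then show "P \<in> conic" using P unfolding conic_eq by blast
qed

lemma point_image_conic:
  assumes "A \<in> SL2"
  shows "point_image A ` conic = conic"
proof
  obtain B where B: "B \<in> SL2" "B ** A = mat 1" using SL2_inverse[OF assms] .
  then have AB: "A ** B = mat 1" using matrix_left_right_inverse by blast
  show "conic \<subseteq> point_image A ` conic"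
  proof
    fix P :: "('a ^ 3) set" assume "P \<in> conic"
    then have "point_image B P \<in> conic" using point_image_conic_subset[OF B(1)] by blast
    then show "P \<in> point_image A ` conic"
      by (intro image_eqI[where x = "point_image B P"]) (simp_all add: point_image_inverse[OF AB])
  qed
qed (rule point_image_conic_subset[OF assms])

lemma dim_image_rho:
  assumes "A \<in> SL2"
  shows "vec.dim ((*v) (rho_mat A) ` W) = vec.dim W"
  using inj_rho_mat[OF assms] by (intro vec.dim_image_eq) (auto intro: inj_on_subset)

lemma line_image_hyperbolic:
  assumes A: "A \<in> SL2" and l: "l \<in> hyperbolic_lines"
  shows "line_image A l \<in> hyperbolic_lines"
proof -
  obtain W where W: "vec.subspace W" "vec.dim W = 2" "l = {P \<in> proj_points. P \<subseteq> W}"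
    using l by (auto simp: hyperbolic_lines_def proj_lines_def)
  have "vec.subspace ((*v) (rho_mat A) ` W)" using W(1) by (rule vec.subspace_image)
  then have "line_image A l \<in> proj_lines"
    unfolding W(3) line_image_points_in[OF A] proj_lines_def
    using dim_image_rho[OF A, of W] W(2)
    by (intro CollectI exI[of _ "(*v) (rho_mat A) ` W"]) simp
  moreover have "line_image A l \<inter> conic = point_image A ` (l \<inter> conic)"
    unfolding line_image_def using point_image_conic[OF A] inj_point_image[OF A]
    by (simp add: image_Int)
  then have "card (line_image A l \<inter> conic) = card (l \<inter> conic)"
    using inj_point_image[OF A] by (simp add: card_image inj_on_subset)
  ultimately show ?thesis using l by (simp add: hyperbolic_lines_def)
qed

text \<open>The vector \<open>e1\<close> serves as base point: its polar line joins the points of the conic on \<open>e0\<close>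
  and \<open>e2\<close>.\<close>

lemma perp_e1:
  assumes "(2::'k::field) \<noteq> 0"
  shows "{x :: 'k ^ 3. polar e1 x = 0} = vec.span {e0, e2}"
proof -
  have "x \<in> vec.span {e0, e2} \<longleftrightarrow> x $ 2 = 0" for x :: "'k ^ 3"
  proof
    assume "x $ 2 = 0"
    then have "x = x$1 *s e0 + x$3 *s e2" by (simp add: vec3_eq_iff)
    also have "\<dots> \<in> vec.span {e0, e2}"
      by (intro vec.span_add vec.span_scale vec.span_base) auto
    finally show "x \<in> vec.span {e0, e2}" .
  qed (auto simp: vec.span_insert vec.span_singleton vec3_eq_iff)
  then show ?thesis using assms by (auto simp: polar_def)
qed

lemma dim_e0_e2: "vec.dim {e0, e2 :: 'k::field ^ 3} = 2"
proof -
  have "e0 \<noteq> (e2 :: 'k ^ 3)" by (simp add: vec3_eq_iff)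
  moreover have "e0 \<notin> vec.span {e2 :: 'k ^ 3}"
    by (auto simp: vec.span_singleton vec3_eq_iff)
  moreover have "e2 \<noteq> (0 :: 'k ^ 3)" by (simp add: vec3_eq_iff)
  ultimately show ?thesis
    by (subst vec.dim_eq_card_independent) (auto simp: vec.independent_insert)
qed

lemma span_e0_neq_span_e2: "vec.span {e0} \<noteq> vec.span {e2 :: 'k::field ^ 3}"
proof
  assume "vec.span {e0} = vec.span {e2 :: 'k ^ 3}"
  moreover have "e0 \<in> vec.span {e0 :: 'k ^ 3}" by (simp add: vec.span_base)
  ultimately show False by (auto simp: vec.span_singleton vec3_eq_iff)
qed

lemma polar_line_e1_hyperbolic:
  assumes two: "(2::'k::field) \<noteq> 0"
  shows "polar_line e1 \<in> (hyperbolic_lines :: ('k ^ 3) set set set)"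
proof -
  have "polar_line e1 \<in> (proj_lines :: ('k ^ 3) set set set)"
    unfolding polar_line_def perp_e1[OF two] proj_lines_def
    using dim_e0_e2[where 'k='k] by (auto intro!: exI[of _ "vec.span {e0, e2}"])
  moreover have "polar_line e1 \<inter> conic = {vec.span {e0}, vec.span {e2 :: 'k ^ 3}}"
  proof (intro equalityI subsetI)
    fix P :: "('k ^ 3) set" assume P: "P \<in> polar_line e1 \<inter> conic"
    then obtain s t where st: "P = vec.span {veronese s t}" "s \<noteq> 0 \<or> t \<noteq> 0"
      unfolding conic_eq by blast
    have "veronese s t \<in> P" using st by (simp add: vec.span_base)
    then have "polar e1 (veronese s t) = 0" using P by (auto simp: polar_line_def)
    then have "s = 0 \<or> t = 0" using two by (simp add: polar_def veronese_def)
    then show "P \<in> {vec.span {e0}, vec.span {e2}}"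
    proof
      assume "s = 0"
      then have "P = vec.span {veronese 0 1}" using st span_veronese_scale[of t 0 1] by simp
      then show ?thesis by (simp add: veronese_def)
    next
      assume "t = 0"
      then have "P = vec.span {veronese 1 0}" using st span_veronese_scale[of s 1 0] by simp
      then show ?thesis by (simp add: veronese_def)
    qed
  next
    fix P :: "('k ^ 3) set" assume P: "P \<in> {vec.span {e0}, vec.span {e2}}"
    then have "P = vec.span {veronese 1 0} \<or> P = vec.span {veronese 0 1}"
      by (auto simp: veronese_def)
    then have c: "P \<in> conic" unfolding conic_eq by force
    have "e0 \<noteq> (0 :: 'k ^ 3)" "e2 \<noteq> (0 :: 'k ^ 3)" by (simp_all add: vec3_eq_iff)
    then have "P \<in> proj_points" using P unfolding proj_points_eq by blast
    moreover have "P \<subseteq> vec.span {e0, e2}"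
      using P vec.span_mono[of "{e0}" "{e0, e2}"] vec.span_mono[of "{e2}" "{e0, e2}"] by blast
    ultimately show "P \<in> polar_line e1 \<inter> conic"
      using c unfolding polar_line_def perp_e1[OF two] by blast
  qed
  ultimately show ?thesis using span_e0_neq_span_e2[where 'k='k] by (simp add: hyperbolic_lines_def)
qed

text \<open>A hyperbolic line joins two points of the conic. These are the images of the points on
  \<open>e0\<close> and \<open>e2\<close> under the matrix whose columns are their parameters, where the second column is
  divided by the determinant \<open>D\<close> in order to land in \<open>SL2\<close>. The same matrix moves the pole \<open>e1\<close> of
  the base line to the pole of the given line.\<close>

lemma hyperbolic_imp_polar_line:
  fixes l :: "('k::field ^ 3) set set"
  assumes two: "(2::'k) \<noteq> 0" and l: "l \<in> hyperbolic_lines"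
  obtains v where "qform v = 1" "l = polar_line v"
proof -
  obtain W where W: "vec.subspace W" "vec.dim W = 2" "l = {P \<in> proj_points. P \<subseteq> W}"
    using l by (auto simp: hyperbolic_lines_def proj_lines_def)
  have "card (l \<inter> conic) = 2" using l by (simp add: hyperbolic_lines_def)
  then obtain P P' where P: "l \<inter> conic = {P, P'}" "P \<noteq> P'" by (auto simp: card_2_iff)
  then have "P \<in> conic" "P' \<in> conic" and PW: "P \<subseteq> W" "P' \<subseteq> W" using W(3) by auto
  then obtain s t s' t' where
    st: "P = vec.span {veronese s t}" "s \<noteq> 0 \<or> t \<noteq> 0" and
    st': "P' = vec.span {veronese s' t'}" "s' \<noteq> 0 \<or> t' \<noteq> 0"
    unfolding conic_eq by blast
  define D where "D = s * t' - s' * t"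
  have D: "D \<noteq> 0" using span_veronese_eq_of_proportional[of s t s' t'] P(2) st st' D_def by auto
  let ?A = "mat2 s (inverse D * s') t (inverse D * t')"
  have "s * (inverse D * t') - inverse D * s' * t = inverse D * D"
    by (simp add: D_def algebra_simps)
  then have A: "?A \<in> SL2" using D by (simp add: mat2_mem_SL2)
  have "rho_mat ?A *v e0 = veronese s t"
    "rho_mat ?A *v e2 = (inverse D)\<^sup>2 *s veronese s' t'"
    by (simp_all add: rho_mat_vec veronese_def vec3_eq_iff power2_eq_square)
  moreover have "veronese s t \<in> W" "veronese s' t' \<in> W"
    using PW st st' vec.span_base by blast+
  ultimately have "vec.span ((*v) (rho_mat ?A) ` {e0, e2}) \<subseteq> W"
    using W(1) by (intro vec.span_minimal) (auto intro: vec.subspace_scale)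
  then have sub: "(*v) (rho_mat ?A) ` vec.span {e0, e2} \<subseteq> W"
    by (simp only: vec.span_image)
  have "(*v) (rho_mat ?A) ` vec.span {e0, e2} = W"
  proof (rule vec.subspace_dim_equal)
    show "vec.subspace ((*v) (rho_mat ?A) ` vec.span {e0, e2})"
      by (rule vec.subspace_image) (rule vec.subspace_span)
    show "vec.dim W \<le> vec.dim ((*v) (rho_mat ?A) ` vec.span {e0, e2})"
      using W(2) by (simp add: dim_image_rho[OF A] dim_e0_e2)
  qed (use W(1) sub in auto)
  then have "l = line_image ?A (polar_line e1)"
    unfolding W(3) polar_line_def perp_e1[OF two] line_image_points_in[OF A] by simp
  then have "l = polar_line (rho_mat ?A *v e1)" by (simp only: line_image_polar_line[OF A])
  moreover have "qform (rho_mat ?A *v e1) = 1" by (simp only: qform_rho[OF A] qform_e1)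
  ultimately show thesis using that by blast
qed

lemma hyperbolic_lines_eq:
  assumes two: "(2::'k::field) \<noteq> 0"
  shows "hyperbolic_lines = polar_line ` {v :: 'k ^ 3. qform v = 1}"
proof (intro equalityI subsetI)
  fix l :: "('k ^ 3) set set" assume "l \<in> hyperbolic_lines"
  then obtain v where "qform v = 1" "l = polar_line v"
    by (rule hyperbolic_imp_polar_line[OF two])
  then show "l \<in> polar_line ` {v. qform v = 1}" by auto
next
  fix l :: "('k ^ 3) set set" assume "l \<in> polar_line ` {v. qform v = 1}"
  then obtain v where v: "qform v = 1" "l = polar_line v" by auto
  obtain A where "A \<in> SL2" "rho_mat A *v e1 = v" using exists_rho_e1[OF two v(1)] .
  then show "l \<in> hyperbolic_lines"
    using line_image_hyperbolic polar_line_e1_hyperbolic[OF two] line_image_polar_line v(2)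
    by metis
qed

lemma polar_uminus: "polar (- v) x = - polar v x"
  by (simp add: polar_def algebra_simps)

lemma polar_line_uminus: "polar_line (- v) = polar_line v"
  by (simp add: polar_line_def polar_uminus)

text \<open>A vector orthogonal to both \<open>e0\<close> and \<open>e2\<close> is a multiple of \<open>e1\<close>, and its norm fixes the
  multiple up to sign. The general case then follows by transitivity.\<close>

lemma polar_line_e1_eq_iff:
  fixes w :: "'k::field ^ 3"
  assumes two: "(2::'k) \<noteq> 0" and w: "qform w = 1"
  shows "polar_line w = polar_line e1 \<longleftrightarrow> w = e1 \<or> w = - e1"
proof
  assume eq: "polar_line w = polar_line e1"
  have perp: "polar w x = 0" if "polar e1 x = 0" "x \<noteq> 0" for x
  proof -
    have "vec.span {x} \<subseteq> vec.span {e0, e2}"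
      using that(1) unfolding perp_e1[OF two, symmetric]
      by (auto simp: vec.span_singleton polar_def)
    then have "vec.span {x} \<in> polar_line e1"
      using that unfolding polar_line_def perp_e1[OF two] by (auto simp: proj_points_eq)
    then have "vec.span {x} \<in> polar_line w" using eq by simp
    then show ?thesis using vec.span_base[of x "{x}"] by (auto simp: polar_line_def)
  qed
  have "w $ 3 = 0" using perp[of e0] by (simp add: polar_def vec3_eq_iff)
  moreover have "w $ 1 = 0" using perp[of e2] by (simp add: polar_def vec3_eq_iff)
  moreover from calculation have "w $ 2 = 1 \<or> w $ 2 = -1"
    using w by (simp add: qform_def power2_eq_1_iff)
  ultimately show "w = e1 \<or> w = - e1" by (auto simp: vec3_eq_iff)
qed (auto simp: polar_line_uminus)

lemma polar_line_eq_iff: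
  fixes v w :: "'k::field ^ 3"
  assumes two: "(2::'k) \<noteq> 0" and v: "qform v = 1" and w: "qform w = 1"
  shows "polar_line v = polar_line w \<longleftrightarrow> w = v \<or> w = - v"
proof
  assume eq: "polar_line v = polar_line w"
  obtain A where A: "A \<in> SL2" "rho_mat A *v e1 = v" using exists_rho_e1[OF two v] .
  obtain B where B: "B \<in> SL2" "\<And>v. rho_mat B *v (rho_mat A *v v) = v"
    "\<And>v. rho_mat A *v (rho_mat B *v v) = v" by (rule rho_mat_SL2_inverse[OF A(1)]) blast
  have "rho_mat B *v v = e1" using A(2) B(2) by blast
  then have "polar_line (rho_mat B *v w) = polar_line e1"
    using eq line_image_polar_line[OF B(1)] by metis
  then have "rho_mat B *v w = e1 \<or> rho_mat B *v w = - e1"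
    using polar_line_e1_eq_iff[OF two] qform_rho[OF B(1)] w by metis
  then have "w = rho_mat A *v e1 \<or> w = rho_mat A *v (- e1)" using B(3) by metis
  then show "w = v \<or> w = - v" using A(2) by (simp add: vec.neg)
qed (auto simp: polar_line_uminus)

section \<open>The orbitals on hyperbolic lines\<close>

lemma hyperbolic_subset_proj_points: "l \<in> hyperbolic_lines \<Longrightarrow> l \<subseteq> proj_points"
  by (auto simp: hyperbolic_lines_def proj_lines_def)

lemma line_action_hyperbolic:
  "l \<in> hyperbolic_lines \<Longrightarrow> line_action (proj_class (rho_mat A)) l = line_image A l"
  by (simp add: line_action_proj_class hyperbolic_subset_proj_points)

lemma transitive_maps_POmega3:
  assumes two: "(2 :: 'k::{field,finite}) \<noteq> 0"
  shows "transitive_maps POmega3 (hyperbolic_lines :: ('k ^ 3) set set set) line_action"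
proof
  let ?L = "hyperbolic_lines :: ('k ^ 3) set set set"
  note simps = carrier_POmega3 line_action_hyperbolic line_image_hyperbolic
  show "finite ?L" by simp
  show "?L \<noteq> {}" using polar_line_e1_hyperbolic[OF two] by blast
  show "line_action g x \<in> ?L" if "g \<in> carrier POmega3" "x \<in> ?L" for g x
    using that by (auto simp: simps)
  show "\<exists>e\<in>carrier POmega3. \<forall>x\<in>?L. line_action e x = x"
    using mat_1_mem_SL2 by (auto simp: simps line_image_one intro!: bexI[of _ "mat 1"])
  show "\<exists>k\<in>carrier POmega3. \<forall>x\<in>?L. line_action k x = line_action g (line_action h x)"
    if gh: "g \<in> carrier POmega3" "h \<in> carrier POmega3" for g h
  proof -
    obtain A B where A: "A \<in> SL2" "g = proj_class (rho_mat A)"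
      and B: "B \<in> SL2" "h = proj_class (rho_mat B)" using gh by (auto simp: carrier_POmega3)
    show ?thesis
      using A B SL2_mult
      by (intro bexI[of _ "proj_class (rho_mat (A ** B))"]) (auto simp: simps line_image_mult)
  qed
  show "\<exists>h\<in>carrier POmega3. \<forall>x\<in>?L. line_action h (line_action g x) = x"
    if g: "g \<in> carrier POmega3" for g
  proof -
    obtain A where A: "A \<in> SL2" "g = proj_class (rho_mat A)"
      using g by (auto simp: carrier_POmega3)
    obtain B where B: "B \<in> SL2" "B ** A = mat 1" using SL2_inverse[OF A(1)] .
    show ?thesis
      using A B by (intro bexI[of _ "proj_class (rho_mat B)"]) (auto simp: simps line_image_inverse)
  qed
  show "\<exists>g\<in>carrier POmega3. line_action g x = y" if xy: "x \<in> ?L" "y \<in> ?L" for x y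
  proof -
    obtain v w where v: "qform v = 1" "x = polar_line v" and w: "qform w = 1" "y = polar_line w"
      using xy unfolding hyperbolic_lines_eq[OF two] by blast
    obtain A where A: "A \<in> SL2" "rho_mat A *v e1 = v" using exists_rho_e1[OF two v(1)] .
    obtain C where C: "C \<in> SL2" "rho_mat C *v e1 = w" using exists_rho_e1[OF two w(1)] .
    obtain B where B: "B \<in> SL2" "B ** A = mat 1" using SL2_inverse[OF A(1)] .
    have "rho_mat (C ** B) *v v = w"
      using rho_mat_inverse[OF B(2), of e1] A(2) C(2)
      by (simp add: rho_mat_mult matrix_vector_mul_assoc[symmetric])
    then have "line_image (C ** B) x = y"
      using v(2) w(2) line_image_polar_line[OF SL2_mult[OF C(1) B(1)]] by metis
    then have "line_action (proj_class (rho_mat (C ** B))) x = y"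
      using line_action_hyperbolic[OF xy(1)] by metis
    then show ?thesis using SL2_mult[OF C(1) B(1)] by (auto simp: carrier_POmega3)
  qed
qed

text \<open>Every orbital contains a pair that starts with the base line, so \<open>base_orbital\<close> maps the
  vectors of norm one onto the set of orbitals.\<close>

definition base_orbital :: "'k::field ^ 3 \<Rightarrow> (('k ^ 3) set set \<times> ('k ^ 3) set set) set" where
  "base_orbital v = transitive_maps.orbital POmega3 line_action (polar_line e1) (polar_line v)"

lemma mem_base_orbital_iff:
  assumes two: "(2 :: 'k::{field,finite}) \<noteq> 0" and v: "qform v = 1"
  shows "(l, m) \<in> base_orbital (v :: 'k ^ 3) \<longleftrightarrow>
    (\<exists>A\<in>SL2. l = polar_line (rho_mat A *v e1) \<and> m = polar_line (rho_mat A *v v))"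
proof -
  have "polar_line v \<in> hyperbolic_lines" using hyperbolic_lines_eq[OF two] v by auto
  then show ?thesis
    unfolding base_orbital_def transitive_maps.orbital_def[OF transitive_maps_POmega3[OF two]]
    by (auto simp: setcompr_eq_image carrier_POmega3 image_image line_action_hyperbolic
        line_image_polar_line polar_line_e1_hyperbolic[OF two])
qed

text \<open>Two pairs that start with the base line lie in the same orbital exactly if a matrix that fixes
  the base line carries one second entry to the other. The signs appear because a line determines its
  vector of norm one only up to sign.\<close>

lemma base_orbital_eq_iff:
  assumes two: "(2 :: 'k::{field,finite}) \<noteq> 0" and v: "qform v = 1" and w: "qform w = 1"
  shows "base_orbital (v :: 'k ^ 3) = base_orbital w \<longleftrightarrow>
    (\<exists>A\<in>SL2. (rho_mat A *v e1 = e1 \<or> rho_mat A *v e1 = - e1) \<and>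
            (rho_mat A *v v = w \<or> rho_mat A *v v = - w))"
proof -
  interpret transitive_maps POmega3 "hyperbolic_lines :: ('k ^ 3) set set set" line_action
    by (rule transitive_maps_POmega3[OF two])
  have L: "polar_line u \<in> hyperbolic_lines" if "qform u = 1" for u :: "'k ^ 3"
    using that hyperbolic_lines_eq[OF two] by auto
  have "base_orbital v = base_orbital w \<longleftrightarrow> (polar_line e1, polar_line w) \<in> base_orbital v"
    unfolding base_orbital_def using orbital_eq_iff L[OF v] L[OF w] L[OF qform_e1] by blast
  also have "\<dots> \<longleftrightarrow> (\<exists>A\<in>SL2. polar_line e1 = polar_line (rho_mat A *v e1) \<and>
      polar_line w = polar_line (rho_mat A *v v))"
    by (rule mem_base_orbital_iff[OF two v])
  also have "\<dots> \<longleftrightarrow> (\<exists>A\<in>SL2. (rho_mat A *v e1 = e1 \<or> rho_mat A *v e1 = - e1) \<and>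
      (rho_mat A *v v = w \<or> rho_mat A *v v = - w))"
    by (intro bex_cong refl conj_cong polar_line_eq_iff[OF two])
       (simp_all add: qform_rho v w qform_e1)
  finally show ?thesis .
qed

text \<open>Fixing \<open>e1\<close> up to sign makes the coordinates \<open>2ab\<close> and \<open>2cd\<close> vanish, so \<open>A\<close> is monomial.\<close>

lemma stabilizer_base_line:
  fixes A :: "'k::field ^ 2 ^ 2"
  assumes two: "(2 :: 'k) \<noteq> 0" and A: "A \<in> SL2"
    and stab: "rho_mat A *v e1 = e1 \<or> rho_mat A *v e1 = - e1"
  shows "A$1$2 = 0 \<and> A$2$1 = 0 \<and> A$1$1 * A$2$2 = 1 \<or>
         A$1$1 = 0 \<and> A$2$2 = 0 \<and> A$1$2 * A$2$1 = -1"
proof -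
  have det: "A$1$1 * A$2$2 - A$1$2 * A$2$1 = 1" using A by (simp add: SL2_def det_2)
  then have bc: "A$1$2 * A$2$1 = A$1$1 * A$2$2 - 1" by (simp add: algebra_simps)
  have "A$1$1 * A$1$2 = 0" "A$2$1 * A$2$2 = 0"
    using stab two by (auto simp: rho_e1 vec3_eq_iff)
  then show ?thesis using bc det by auto
qed

text \<open>A complete invariant of the orbital of \<open>v = (y, x, z)\<close>. The vector \<open>v\<close> is determined by its
  line up to sign, and the monomial matrices act by \<open>(y, x, z) \<mapsto> (t\<^sup>2 y, x, z / t\<^sup>2)\<close> and
  \<open>(y, x, z) \<mapsto> (z, -x, y)\<close>. So \<open>x\<^sup>2\<close> is invariant, and \<open>y\<close> and \<open>-z\<close> matter only up to squares
  and as an unordered pair; multiplying them by \<open>x\<close> makes them insensitive to the sign of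
  \<open>v\<close>. If \<open>x = 0\<close>, then \<open>y z = -1\<close>, so that the class of \<open>z\<close> is that of \<open>-y\<close>, and what remains
  is the class of \<open>y\<close> up to sign.\<close>

definition orbital_inv :: "'k::field ^ 3 \<Rightarrow> 'k \<times> int set" where
  "orbital_inv v = ((v$2)\<^sup>2,
     if v$2 = 0 then {quad_char (v$1), quad_char (- v$1)}
     else {quad_char (v$2 * v$1), quad_char (- (v$2 * v$3))})"

lemma qform_eq_1_iff: "qform v = 1 \<longleftrightarrow> v$1 * v$3 = (v$2)\<^sup>2 - 1"
  by (auto simp: qform_def algebra_simps)

lemma orbital_inv_uminus: "orbital_inv (- v) = orbital_inv v"
  by (auto simp: orbital_inv_def)

lemma quad_char_of_product_neg_1:
  assumes "y * z = (-1 :: 'k::field)"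
  shows "quad_char z = quad_char (- y)" and "quad_char (- z) = quad_char y"
proof -
  have "z \<noteq> 0" using assms by auto
  have "z\<^sup>2 * y = y * z * z" by (simp add: power2_eq_square)
  then have "z = z\<^sup>2 * (- y)" "- z = z\<^sup>2 * y" using assms by simp_all
  then show "quad_char z = quad_char (- y)" and "quad_char (- z) = quad_char y"
    using quad_char_square_mult[OF \<open>z \<noteq> 0\<close>] by metis+
qed

lemma orbital_inv_rho:
  fixes v :: "'k::field ^ 3"
  assumes two: "(2 :: 'k) \<noteq> 0" and A: "A \<in> SL2" and v: "qform v = 1"
    and stab: "rho_mat A *v e1 = e1 \<or> rho_mat A *v e1 = - e1"
  shows "orbital_inv (rho_mat A *v v) = orbital_inv v"
  using stabilizer_base_line[OF two A stab]
proof (elim disjE conjE)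
  assume h: "A$1$2 = 0" "A$2$1 = 0" "A$1$1 * A$2$2 = 1"
  then have nz: "A$1$1 \<noteq> 0" "A$2$2 \<noteq> 0" by auto
  have "orbital_inv (rho_mat A *v v) = ((v$2)\<^sup>2,
     if v$2 = 0 then {quad_char ((A$1$1)\<^sup>2 * v$1), quad_char ((A$1$1)\<^sup>2 * (- v$1))}
     else {quad_char ((A$1$1)\<^sup>2 * (v$2 * v$1)), quad_char ((A$2$2)\<^sup>2 * (- (v$2 * v$3)))})"
    using h by (simp add: orbital_inv_def rho_mat_vec mult.left_commute)
  then show ?thesis
    unfolding quad_char_square_mult[OF nz(1)] quad_char_square_mult[OF nz(2)] orbital_inv_def
    by simp
next
  assume h: "A$1$1 = 0" "A$2$2 = 0" "A$1$2 * A$2$1 = -1"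
  then have nz: "A$1$2 \<noteq> 0" "A$2$1 \<noteq> 0" by auto
  have "orbital_inv (rho_mat A *v v) = ((v$2)\<^sup>2,
     if v$2 = 0 then {quad_char ((A$1$2)\<^sup>2 * v$3), quad_char ((A$1$2)\<^sup>2 * (- v$3))}
     else {quad_char ((A$1$2)\<^sup>2 * (- (v$2 * v$3))), quad_char ((A$2$1)\<^sup>2 * (v$2 * v$1))})"
    using h by (simp add: orbital_inv_def rho_mat_vec mult.left_commute)
  also have "\<dots> = orbital_inv v"
    unfolding quad_char_square_mult[OF nz(1)] quad_char_square_mult[OF nz(2)] orbital_inv_def
    using v quad_char_of_product_neg_1[of "v$1" "v$3"] by (auto simp: qform_eq_1_iff)
  finally show ?thesis .
qed

lemma base_orbital_uminus: "base_orbital (- v) = base_orbital v"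
  by (simp add: base_orbital_def polar_line_uminus)

lemma base_orbital_eqI:
  fixes v :: "'k::{field,finite} ^ 3"
  assumes two: "(2 :: 'k) \<noteq> 0" and v: "qform v = 1" and A: "A \<in> SL2"
    and stab: "rho_mat A *v e1 = e1 \<or> rho_mat A *v e1 = - e1" and w: "rho_mat A *v v = w"
  shows "base_orbital w = base_orbital v"
  using base_orbital_eq_iff[OF two v, of w] qform_rho[OF A, of v] assms by auto

lemma base_orbital_torus:
  fixes v :: "'k::{field,finite} ^ 3"
  assumes two: "(2 :: 'k) \<noteq> 0" and v: "qform v = 1" and t: "t \<noteq> 0"
  shows "base_orbital (vector [t\<^sup>2 * v$1, v$2, v$3 / t\<^sup>2]) = base_orbital v"
  using t by (intro base_orbital_eqI[OF two v, of "mat2 t 0 0 (inverse t)"])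
    (auto simp: mat2_mem_SL2 rho_mat_vec vec3_eq_iff field_simps)

text \<open>The action of the antidiagonal matrix, followed by a change of sign that restores the middle
  coordinate.\<close>

lemma base_orbital_flip:
  fixes v :: "'k::{field,finite} ^ 3"
  assumes two: "(2 :: 'k) \<noteq> 0" and v: "qform v = 1"
  shows "base_orbital (vector [- v$3, v$2, - v$1]) = base_orbital v"
proof -
  have "base_orbital (vector [v$3, - v$2, v$1]) = base_orbital v"
    by (intro base_orbital_eqI[OF two v, of "mat2 0 1 (-1) 0"])
      (auto simp: mat2_mem_SL2 rho_mat_vec vec3_eq_iff)
  moreover have "vector [- v$3, v$2, - v$1] = - (vector [v$3, - v$2, v$1] :: 'k ^ 3)"
    by (simp add: vec3_eq_iff)
  ultimately show ?thesis by (simp add: base_orbital_uminus)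
qed

text \<open>The condition on the characters gives square factors for the first and for the third coordinate.
  Because \<open>v$1 * v$3\<close> is determined by the middle coordinate, a single diagonal matrix realizes
  both, and the first factor can be used unless the first coordinate vanishes.\<close>

lemma base_orbital_eq_of_quad_char:
  fixes v w :: "'k::{field,finite} ^ 3"
  assumes odd: "odd CARD('k)" and v: "qform v = 1" and w: "qform w = 1"
    and eq: "v$2 = w$2" "quad_char (v$1) = quad_char (w$1)" "quad_char (v$3) = quad_char (w$3)"
  shows "base_orbital v = base_orbital w"
proof -
  note two = two_neq_zero_of_odd_card[OF odd]
  have prod: "v$1 * v$3 = w$1 * w$3"
    using v w eq(1) by (simp add: qform_eq_1_iff)
  obtain t where t: "t \<noteq> 0" "w$1 = t\<^sup>2 * v$1"
    by (rule quad_char_eq_imp_square_multiple[OF odd eq(2)])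
  obtain s where s: "s \<noteq> 0" "w$3 = s\<^sup>2 * v$3"
    by (rule quad_char_eq_imp_square_multiple[OF odd eq(3)])
  have "\<exists>r. r \<noteq> 0 \<and> w = vector [r\<^sup>2 * v$1, v$2, v$3 / r\<^sup>2]"
  proof (cases "v$1 = 0")
    case True
    then have "w = vector [(inverse s)\<^sup>2 * v$1, v$2, v$3 / (inverse s)\<^sup>2]"
      using eq t s by (simp add: vec3_eq_iff power_inverse divide_inverse mult.commute)
    then show ?thesis using s by (metis nonzero_imp_inverse_nonzero)
  next
    case False
    then have "v$3 = t\<^sup>2 * w$3" using prod t(2) by simp
    then have "w = vector [t\<^sup>2 * v$1, v$2, v$3 / t\<^sup>2]"
      using eq t by (simp add: vec3_eq_iff)
    then show ?thesis using t by blast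
  qed
  then show ?thesis using base_orbital_torus[OF two v] by metis
qed

lemma quad_char_mult_cancel:
  assumes odd: "odd CARD('k::{field,finite})" and "x \<noteq> 0"
    and "quad_char (x * y) = quad_char (x * z :: 'k)"
  shows "quad_char y = quad_char z"
  using assms by (simp add: quad_char_mult[OF odd])

text \<open>The unordered pairs in the invariants agree either entry by entry or crosswise. A crosswise
  agreement is made direct by the flip if the middle coordinate is nonzero, and by the change of sign
  otherwise.\<close>

lemma base_orbital_eq_of_orbital_inv_same_middle:
  fixes v w :: "'k::{field,finite} ^ 3"
  assumes odd: "odd CARD('k)" and v: "qform v = 1" and w: "qform w = 1"
    and eq: "v$2 = w$2" and inv: "orbital_inv v = orbital_inv w"
  shows "base_orbital v = base_orbital w"
proof -
  note two = two_neq_zero_of_odd_card[OF odd]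
  let ?u = "vector [- w$3, w$2, - w$1] :: 'k ^ 3"
  have u: "qform ?u = 1" using w by (simp add: qform_def mult.commute)
  have minus_w: "qform (- w) = 1" using w by (simp add: qform_def)
  show ?thesis
  proof (cases "v$2 = 0")
    case False
    define x where "x = v$2"
    have x: "x \<noteq> 0" "- x \<noteq> 0" using False by (simp_all add: x_def)
    have "{quad_char (x * v$1), quad_char ((- x) * v$3)}
        = {quad_char (x * w$1), quad_char ((- x) * w$3)}"
      using inv False eq by (simp add: orbital_inv_def x_def)
    then consider
      "quad_char (x * v$1) = quad_char (x * w$1)" "quad_char ((-x) * v$3) = quad_char ((-x) * w$3)"
      | "quad_char (x * v$1) = quad_char (x * (- w$3))"
        "quad_char ((-x) * v$3) = quad_char ((-x) * (- w$1))"
      by (auto simp: doubleton_eq_iff)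
    then show ?thesis
    proof cases
      case 1
      then show ?thesis
        using base_orbital_eq_of_quad_char[OF odd v w eq] quad_char_mult_cancel[OF odd] x by blast
    next
      case 2
      then have "quad_char (v$1) = quad_char (- w$3)" "quad_char (v$3) = quad_char (- w$1)"
        using quad_char_mult_cancel[OF odd] x by blast+
      then have "base_orbital v = base_orbital ?u"
        using eq by (intro base_orbital_eq_of_quad_char[OF odd v u]) simp_all
      then show ?thesis using base_orbital_flip[OF two w] by simp
    qed
  next
    case True
    then have "v$1 * v$3 = -1" "w$1 * w$3 = -1"
      using v w eq by (simp_all add: qform_eq_1_iff)
    note third = this[THEN quad_char_of_product_neg_1(1)] this[THEN quad_char_of_product_neg_1(2)]
    have "{quad_char (v$1), quad_char (- v$1)} = {quad_char (w$1), quad_char (- w$1)}"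
      using inv True eq by (simp add: orbital_inv_def)
    then consider
      "quad_char (v$1) = quad_char (w$1)" "quad_char (- v$1) = quad_char (- w$1)"
      | "quad_char (v$1) = quad_char (- w$1)" "quad_char (- v$1) = quad_char (w$1)"
      by (auto simp: doubleton_eq_iff)
    then show ?thesis
    proof cases
      case 1
      then show ?thesis using base_orbital_eq_of_quad_char[OF odd v w eq] third by simp
    next
      case 2
      then have "base_orbital v = base_orbital (- w)"
        using eq True third by (intro base_orbital_eq_of_quad_char[OF odd v minus_w]) simp_all
      then show ?thesis by (simp add: base_orbital_uminus)
    qed
  qed
qed

lemma base_orbital_eq_iff_orbital_inv:
  fixes v w :: "'k::{field,finite} ^ 3"
  assumes odd: "odd CARD('k)" and v: "qform v = 1" and w: "qform w = 1"
  shows "base_orbital v = base_orbital w \<longleftrightarrow> orbital_inv v = orbital_inv w"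
proof
  note two = two_neq_zero_of_odd_card[OF odd]
  assume "base_orbital v = base_orbital w"
  then obtain A where A: "A \<in> SL2" "rho_mat A *v e1 = e1 \<or> rho_mat A *v e1 = - e1"
    "rho_mat A *v v = w \<or> rho_mat A *v v = - w"
    unfolding base_orbital_eq_iff[OF two v w] by blast
  then show "orbital_inv v = orbital_inv w"
    using orbital_inv_rho[OF two A(1) v A(2)] orbital_inv_uminus by metis
next
  assume inv: "orbital_inv v = orbital_inv w"
  then have "v$2 = w$2 \<or> v$2 = (- w)$2" by (simp add: orbital_inv_def power2_eq_iff)
  then show "base_orbital v = base_orbital w"
  proof
    assume "v$2 = w$2"
    then show ?thesis
      using base_orbital_eq_of_orbital_inv_same_middle[OF odd v w _ inv] by blast
  next
    assume "v$2 = (- w)$2"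
    moreover have "qform (- w) = 1" using w by (simp add: qform_def)
    ultimately have "base_orbital v = base_orbital (- w)"
      using base_orbital_eq_of_orbital_inv_same_middle[OF odd v] inv orbital_inv_uminus by metis
    then show ?thesis by (simp add: base_orbital_uminus)
  qed
qed

lemma card_image_eq_of_same_fibres:
  assumes "\<And>x y. x \<in> C \<Longrightarrow> y \<in> C \<Longrightarrow> f x = f y \<longleftrightarrow> g x = g y"
  shows "card (f ` C) = card (g ` C)"
proof -
  define h where "h = (\<lambda>b. g (SOME x. x \<in> C \<and> f x = b))"
  have h: "h (f x) = g x" if "x \<in> C" for x
  proof -
    have "(SOME y. y \<in> C \<and> f y = f x) \<in> C \<and> f (SOME y. y \<in> C \<and> f y = f x) = f x"
      by (rule someI[of _ x]) (use that in simp)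
    then show ?thesis using assms that unfolding h_def by blast
  qed
  have "bij_betw h (f ` C) (g ` C)"
    unfolding bij_betw_def
  proof
    show "inj_on h (f ` C)" using h assms by (auto simp: inj_on_def)
    show "h ` f ` C = g ` C" using h by (force simp: image_image)
  qed
  then show ?thesis by (rule bij_betw_same_card)
qed

lemma card_orbital_scheme_POmega3:
  assumes odd: "odd CARD('k::{field,finite})"
  shows "card (orbital_scheme POmega3 (hyperbolic_lines :: ('k ^ 3) set set set) line_action)
    = card (orbital_inv ` {v :: 'k ^ 3. qform v = 1})"
proof -
  note two = two_neq_zero_of_odd_card[OF odd]
  interpret transitive_maps POmega3 "hyperbolic_lines :: ('k ^ 3) set set set" line_action
    by (rule transitive_maps_POmega3[OF two])
  have "orbital_scheme POmega3 (hyperbolic_lines :: ('k ^ 3) set set set) line_action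
      = base_orbital ` {v :: 'k ^ 3. qform v = 1}"
    unfolding orbital_scheme_eq_image[OF polar_line_e1_hyperbolic[OF two]]
    by (simp add: hyperbolic_lines_eq[OF two] image_image base_orbital_def)
  moreover have "card (base_orbital ` {v :: 'k ^ 3. qform v = 1})
      = card (orbital_inv ` {v :: 'k ^ 3. qform v = 1})"
    by (rule card_image_eq_of_same_fibres) (simp add: base_orbital_eq_iff_orbital_inv[OF odd])
  ultimately show ?thesis by (simp only:)
qed

section \<open>Counting the orbitals\<close>

text \<open>For \<open>s = x\<^sup>2\<close> different from \<open>1\<close>, this is the product of the two characters in the invariant of
  \<open>v = (y, x, z)\<close>, because \<open>(x y) (- x z) = x\<^sup>2 (1 - x\<^sup>2)\<close> and, for \<open>x = 0\<close>,
  \<open>y (- y) = (-1) y\<^sup>2\<close>. It thus tells whether \<open>s\<close> belongs to two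
  orbitals (equal characters, of either sign) or to a single one (opposite characters).\<close>

definition splitting_char :: "'k::field \<Rightarrow> int" where
  "splitting_char s = (if s = 0 then quad_char (-1 :: 'k) else quad_char (1 - s))"

text \<open>The second components of the invariants with first component \<open>s\<close>. The case \<open>s = 1\<close> is special:
  there \<open>y z = 0\<close>, so one of the two characters is \<open>0\<close> and the other is arbitrary.\<close>

definition char_sets :: "'k::field \<Rightarrow> int set set" where
  "char_sets s = (if s = 1 then {{0}, {0, 1}, {0, -1}}
     else (\<lambda>c. {c, splitting_char s * c}) ` {1, -1})"

lemma splitting_char_cases:
  "(s :: 'a::field) \<noteq> 1 \<Longrightarrow> splitting_char s = 1 \<or> splitting_char s = -1"
  using quad_char_cases[of "-1 :: 'a"] quad_char_cases[of "1 - s"] by (auto simp: splitting_char_def)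

lemma card_char_sets:
  "card (char_sets s) = (if s = 1 then 3 else if splitting_char s = 1 then 2 else 1)"
proof (cases "s = 1")
  case True
  then show ?thesis by (simp add: char_sets_def doubleton_eq_iff insert_eq_iff card_insert_if)
next
  case False
  then show ?thesis
    using splitting_char_cases[OF False] by (auto simp: char_sets_def insert_commute)
qed

lemma orbital_inv_generic:
  fixes v :: "'k::{field,finite} ^ 3"
  assumes odd: "odd CARD('k)" and v: "qform v = 1" and s: "(v$2)\<^sup>2 \<noteq> 1"
  defines "c \<equiv> quad_char (if v$2 = 0 then v$1 else v$2 * v$1)"
  shows "orbital_inv v = ((v$2)\<^sup>2, {c, splitting_char ((v$2)\<^sup>2) * c})"
proof (cases "v$2 = 0")
  case True
  have "quad_char (- v$1) = quad_char (-1 :: 'k) * quad_char (v$1)"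
    using quad_char_mult[OF odd, of "-1" "v$1"] by simp
  then show ?thesis using True by (simp add: orbital_inv_def splitting_char_def c_def)
next
  case False
  have "v$1 * v$3 \<noteq> 0" using v s by (simp add: qform_eq_1_iff)
  then have "v$1 \<noteq> 0" by auto
  have "(v$2 * v$1) * (- (v$2 * v$3)) = (v$2)\<^sup>2 * - (v$1 * v$3)"
    by (simp add: power2_eq_square algebra_simps)
  also have "\<dots> = (v$2)\<^sup>2 * (1 - (v$2)\<^sup>2)" using v by (simp add: qform_eq_1_iff)
  finally have "quad_char ((v$2 * v$1) * (- (v$2 * v$3))) = quad_char (1 - (v$2)\<^sup>2)"
    using False by (simp only: quad_char_square_mult not_False_eq_True)
  then have prod: "c * quad_char (- (v$2 * v$3)) = splitting_char ((v$2)\<^sup>2)"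
    using False by (simp only: quad_char_mult[OF odd] c_def splitting_char_def if_False)
       (simp add: quad_char_mult[OF odd])
  have "c = 1 \<or> c = -1"
    using False \<open>v$1 \<noteq> 0\<close> quad_char_cases[of "v$2 * v$1"] by (simp add: c_def)
  then have "c * c = 1" by auto
  then have "quad_char (- (v$2 * v$3)) = splitting_char ((v$2)\<^sup>2) * c"
    using prod by (metis mult.assoc mult.commute mult.right_neutral)
  then show ?thesis using False by (simp add: orbital_inv_def c_def)
qed

lemma orbital_inv_image:
  assumes odd: "odd CARD('k::{field,finite})"
  shows "orbital_inv ` {v :: 'k ^ 3. qform v = 1} = Sigma {s. \<exists>x. s = x\<^sup>2} char_sets"
proof (intro equalityI subsetI)
  fix p assume "p \<in> orbital_inv ` {v :: 'k ^ 3. qform v = 1}"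
  then obtain v :: "'k ^ 3" where v: "qform v = 1" "p = orbital_inv v" by auto
  show "p \<in> Sigma {s. \<exists>x. s = x\<^sup>2} char_sets"
  proof (cases "(v$2)\<^sup>2 = 1")
    case True
    then have "v$1 = 0 \<or> v$3 = 0" using v by (simp add: qform_eq_1_iff)
    moreover have "v$2 \<noteq> 0" using True by auto
    ultimately obtain y :: 'k where y: "p = (1, {0, quad_char y})"
      using True v(2) by (auto simp: orbital_inv_def insert_commute)
    then show ?thesis
      using quad_char_cases[of y] by (cases "y = 0") (auto simp: char_sets_def intro: exI[of _ 1])
  next
    case False
    have "(v$2)\<^sup>2 - 1 \<noteq> 0" using False by simp
    then have "v$1 \<noteq> 0" using v(1) by (auto simp: qform_eq_1_iff)
    then have "quad_char (if v$2 = 0 then v$1 else v$2 * v$1) \<in> {1, -1}"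
      using quad_char_cases[of "v$1"] quad_char_cases[of "v$2 * v$1"] by auto
    then show ?thesis
      using False v orbital_inv_generic[OF odd v(1) False] unfolding char_sets_def by auto
  qed
next
  fix p assume "p \<in> Sigma {s :: 'k. \<exists>x. s = x\<^sup>2} char_sets"
  then obtain x C where p: "p = (x\<^sup>2, C)" "C \<in> char_sets (x\<^sup>2)" by auto
  obtain n :: 'k where n: "quad_char n = -1" by (rule exists_nonsquare[OF odd])
  have reached: "p \<in> orbital_inv ` {v :: 'k ^ 3. qform v = 1}"
    if "qform v = 1" "orbital_inv v = p" for v :: "'k ^ 3"
    using that by blast
  show "p \<in> orbital_inv ` {v :: 'k ^ 3. qform v = 1}"
  proof (cases "x\<^sup>2 = 1")
    case True
    then consider "C = {0}" | "C = {0, 1}" | "C = {0, -1}" using p by (auto simp: char_sets_def)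
    then show ?thesis
    proof cases
      case 1
      then show ?thesis using True p
        by (intro reached[of e1]) (auto simp: qform_def orbital_inv_def)
    next
      case 2
      then show ?thesis using True p
        by (intro reached[of "vector [1, 1, 0]"])
           (auto simp: qform_def orbital_inv_def insert_commute)
    next
      case 3
      then show ?thesis using True p n
        by (intro reached[of "vector [n, 1, 0]"])
           (auto simp: qform_def orbital_inv_def insert_commute)
    qed
  next
    case False
    then have "C \<in> (\<lambda>c. {c, splitting_char (x\<^sup>2) * c}) ` {1, -1}"
      using p(2) by (simp only: char_sets_def if_False)
    then obtain c :: int where c: "c = 1 \<or> c = -1" "C = {c, splitting_char (x\<^sup>2) * c}"
      by blast
    obtain m :: 'k where m: "quad_char m = c"
      using c n quad_char_1 by metis
    have "m \<noteq> 0" using m c by auto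
    define y where "y = (if x = 0 then m else m / x)"
    have y: "y \<noteq> 0" "(if x = 0 then y else x * y) = m"
      using \<open>m \<noteq> 0\<close> by (auto simp: y_def)
    \<comment> \<open>The last coordinate is the one that \<open>qform ?v = 1\<close> requires.\<close>
    let ?v = "vector [y, x, (x\<^sup>2 - 1) / y] :: 'k ^ 3"
    have v: "qform ?v = 1" using y by (simp add: qform_eq_1_iff)
    show ?thesis
      using orbital_inv_generic[OF odd v] False y m c p by (intro reached[OF v]) auto
  qed
qed

text \<open>The squares \<open>1\<close> and \<open>0\<close> contribute \<open>3\<close>, and \<open>2\<close> or \<open>1\<close>; the other squares contribute \<open>1\<close>
  each, and once more if \<open>1 - s\<close> is a nonzero square.\<close>

lemma card_orbital_inv_image:
  assumes odd: "odd CARD('k::{field,finite})"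
  shows "card (orbital_inv ` {v :: 'k ^ 3. qform v = 1})
    = 2 + (if quad_char (-1 :: 'k) = 1 then 2 else 1) + card {s :: 'k. quad_char s = 1}
      + card {s :: 'k. quad_char s = 1 \<and> quad_char (1 - s) = 1}"
proof -
  let ?Q = "{s :: 'k. quad_char s = 1}"
  have squares: "{s :: 'k. \<exists>x. s = x\<^sup>2} = insert 0 (insert 1 (?Q - {1}))"
    by (auto simp: quad_char_eq_1_iff intro: exI[of _ 0] exI[of _ 1])
  have "card (orbital_inv ` {v :: 'k ^ 3. qform v = 1})
      = (\<Sum>s\<in>{s :: 'k. \<exists>x. s = x\<^sup>2}. card (char_sets s))"
    unfolding orbital_inv_image[OF odd] by (rule card_SigmaI) (auto simp: char_sets_def)
  also have "\<dots> = card (char_sets (0 :: 'k)) + card (char_sets (1 :: 'k))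
      + (\<Sum>s\<in>?Q - {1}. card (char_sets s))"
    unfolding squares by (simp del: insert_Diff_single)
  also have "(\<Sum>s\<in>?Q - {1}. card (char_sets s))
      = (\<Sum>s\<in>?Q - {1}. 1 + (if quad_char (1 - s) = 1 then 1 else 0))"
    by (rule sum.cong) (auto simp: card_char_sets splitting_char_def)
  also have "\<dots> = card (?Q - {1}) + card {s \<in> ?Q - {1}. quad_char (1 - s) = 1}"
    by (simp only: sum.distrib) (simp add: sum.If_cases Int_def)
  also have "{s \<in> ?Q - {1}. quad_char (1 - s) = 1}
      = {s :: 'k. quad_char s = 1 \<and> quad_char (1 - s) = 1}"
    by auto
  also have "card (?Q - {1}) = card ?Q - 1" by simp
  finally have "card (orbital_inv ` {v :: 'k ^ 3. qform v = 1})
      = 2 + (if quad_char (-1 :: 'k) = 1 then 2 else 1) + (card ?Q - 1 + 1)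
        + card {s :: 'k. quad_char s = 1 \<and> quad_char (1 - s) = 1}"
    by (simp add: card_char_sets splitting_char_def)
  moreover have "?Q \<noteq> {}" using quad_char_1 by blast
  then have "card ?Q - 1 + 1 = card ?Q" by (simp add: card_gt_0_iff Suc_leI)
  ultimately show ?thesis by (simp only:)
qed

section \<open>Pairs of lines that cannot be interchanged\<close>

text \<open>Let \<open>a, b, c, d\<close> be the entries of a matrix \<open>A\<close> that interchanges the lines of \<open>e1\<close> and
  \<open>v = (y, x, z)\<close>. Then \<open>v\<close> is \<open>\<plusminus>(2ab, ad + bc, 2cd)\<close>, and the outer coordinates of
  \<open>rho_mat A *v v\<close> vanish; they factor as \<open>\<plusminus>2b(a + d)(a\<^sup>2 + bc)\<close> and \<open>\<plusminus>2c(a + d)(bc + d\<^sup>2)\<close>. If \<open>A\<close> has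
  trace zero, the determinant gives \<open>-2(1 \<plusminus> x) = (2a)\<^sup>2\<close>. Otherwise \<open>a = d\<close> and \<open>bc = -a\<^sup>2\<close>, so that
  \<open>x = 0\<close> and \<open>2a\<^sup>2 = 1\<close>.\<close>

lemma interchange_imp_square:
  fixes v :: "'k::field ^ 3"
  assumes two: "(2 :: 'k) \<noteq> 0" and A: "A \<in> SL2" and nz: "v$1 \<noteq> 0"
    and there: "rho_mat A *v e1 = v \<or> rho_mat A *v e1 = - v"
    and return: "rho_mat A *v v = e1 \<or> rho_mat A *v v = - e1"
  shows "quad_char (- 2 * (1 + v$2)) = 1 \<or> quad_char (- 2 * (1 - v$2)) = 1 \<or>
    v$2 = 0 \<and> quad_char (2 :: 'k) = 1"
proof -
  define a b c d where ent: "a = A$1$1" "b = A$1$2" "c = A$2$1" "d = A$2$2"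
  have det: "a * d - b * c = 1" using A by (simp add: SL2_def det_2 ent)
  obtain e :: 'k where e: "e = 1 \<or> e = -1"
    and v: "v$1 = e * (2 * a * b)" "v$2 = e * (a * d + b * c)" "v$3 = e * (2 * c * d)"
  proof (cases "rho_mat A *v e1 = v")
    case True
    then show thesis by (intro that[of 1]) (auto simp: rho_e1 vec3_eq_iff ent)
  next
    case False
    then have "v = - (rho_mat A *v e1)" using there by auto
    then show thesis by (intro that[of "-1"]) (auto simp: rho_e1 ent)
  qed
  have ab: "a \<noteq> 0" "b \<noteq> 0" using nz v(1) by auto
  have "a\<^sup>2 * v$1 + 2 * a * b * v$2 + b\<^sup>2 * v$3 = 0"
    using return by (auto simp: rho_mat_vec vec3_eq_iff ent)
  moreover have "a\<^sup>2 * v$1 + 2 * a * b * v$2 + b\<^sup>2 * v$3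
      = e * 2 * b * (a + d) * (a * a + b * c)"
    by (simp add: v power2_eq_square algebra_simps)
  ultimately have r1: "a + d = 0 \<or> a * a + b * c = 0" using e two ab by auto
  have "c\<^sup>2 * v$1 + 2 * c * d * v$2 + d\<^sup>2 * v$3 = 0"
    using return by (auto simp: rho_mat_vec vec3_eq_iff ent)
  moreover have "c\<^sup>2 * v$1 + 2 * c * d * v$2 + d\<^sup>2 * v$3
      = e * 2 * c * (a + d) * (b * c + d * d)"
    by (simp add: v power2_eq_square algebra_simps)
  ultimately have r3: "c = 0 \<or> a + d = 0 \<or> b * c + d * d = 0" using e two by auto
  show ?thesis
  proof (cases "a + d = 0")
    case True
    then have d: "d = - a" by (simp add: eq_neg_iff_add_eq_0 add.commute)
    have "b * c = a * d - 1" using det by (simp add: algebra_simps)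
    then have bc: "b * c = - 1 - a * a" by (simp add: d)
    have "- 2 * (1 + e * v$2) = (2 * a)\<^sup>2"
      using e by (auto simp: v d bc power2_eq_square algebra_simps)
    then have "quad_char (- 2 * (1 + e * v$2)) = 1"
      using quad_char_square[of "2 * a"] two ab by simp
    then show ?thesis using e by auto
  next
    case False
    then have bc: "b * c = - (a * a)" using r1 by (simp add: eq_neg_iff_add_eq_0 add.commute)
    then have "c \<noteq> 0" using ab by auto
    then have "b * c + d * d = 0" using r3 False by blast
    then have "d\<^sup>2 = a\<^sup>2" by (simp add: bc power2_eq_square)
    then have d: "d = a" using False by (auto simp: power2_eq_iff)
    then have "2 * a * a = 1" using det bc by (simp add: algebra_simps)
    then have "2 = (inverse a)\<^sup>2" using ab by (simp add: power2_eq_square field_simps)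
    then have "quad_char (2 :: 'k) = 1" using quad_char_square[of "inverse a"] ab by simp
    moreover have "v$2 = 0" by (simp add: v d bc)
    ultimately show ?thesis by blast
  qed
qed

text \<open>If \<open>-1\<close> is not a square, \<open>x = 1\<close> works, since then the two values are \<open>-4\<close> and \<open>0\<close>. If \<open>-1\<close> is a
  square, the sign is harmless, and two nonsquares \<open>u\<close> and \<open>w\<close> with sum \<open>4\<close> are of the form
  \<open>2(1 + x)\<close> and \<open>2(1 - x)\<close>; here \<open>x = 0\<close> means that \<open>u = w = 2\<close>.\<close>

lemma exists_obstruction:
  assumes odd: "odd CARD('k::{field,finite})"
  obtains x :: "'k::{field,finite}" where "quad_char (- 2 * (1 + x)) \<noteq> 1" "quad_char (- 2 * (1 - x)) \<noteq> 1"
    "x = 0 \<Longrightarrow> quad_char (2 :: 'k) \<noteq> 1"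
proof -
  note two = two_neq_zero_of_odd_card[OF odd]
  have four: "quad_char (2\<^sup>2 :: 'k) = 1" using two by (rule quad_char_square)
  show thesis
  proof (cases "quad_char (-1 :: 'k) = 1")
    case False
    have "quad_char (2\<^sup>2 * (-1) :: 'k) \<noteq> 1"
      using False by (subst quad_char_square_mult[OF two])
    then show ?thesis by (intro that[of 1]) simp_all
  next
    case True
    obtain u w :: 'k where uw: "quad_char u = -1" "quad_char w = -1" "u + w = 2\<^sup>2"
      by (rule nonsquares_summing_to_square[OF odd four])
    define x where "x = u / 2 - 1"
    have x: "2 * (1 + x) = u" "2 * (1 - x) = w"
      using two uw(3) by (simp_all add: x_def algebra_simps)
    have "quad_char (- y) = quad_char y" for y :: 'k
      using quad_char_mult[OF odd, of "-1" y] True by simp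
    then show ?thesis using x uw by (intro that[of x]) auto
  qed
qed

lemma not_symmetric_scheme_POmega3:
  assumes odd: "odd CARD('k::{field,finite})"
  shows "\<not> symmetric_scheme
    (orbital_scheme POmega3 (hyperbolic_lines :: ('k ^ 3) set set set) line_action)"
proof
  note two = two_neq_zero_of_odd_card[OF odd]
  interpret transitive_maps POmega3 "hyperbolic_lines :: ('k ^ 3) set set set" line_action
    by (rule transitive_maps_POmega3[OF two])
  assume sym: "symmetric_scheme
    (orbital_scheme POmega3 (hyperbolic_lines :: ('k ^ 3) set set set) line_action)"
  obtain x :: 'k where x: "quad_char (- 2 * (1 + x)) \<noteq> 1" "quad_char (- 2 * (1 - x)) \<noteq> 1"
    "x = 0 \<Longrightarrow> quad_char (2 :: 'k) \<noteq> 1" by (rule exists_obstruction[OF odd]) blast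
  let ?v = "vector [1, x, x\<^sup>2 - 1] :: 'k ^ 3"
  have v: "qform ?v = 1" by (simp add: qform_eq_1_iff)
  have "polar_line ?v \<in> hyperbolic_lines" using v by (auto simp: hyperbolic_lines_eq[OF two])
  note L = polar_line_e1_hyperbolic[OF two] this
  obtain g where "g \<in> carrier POmega3" "line_action g (polar_line e1) = polar_line ?v"
    "line_action g (polar_line ?v) = polar_line e1"
    using symmetric_scheme_imp_reversal[OF sym L] by blast
  then obtain A where A: "A \<in> SL2" "polar_line ?v = polar_line (rho_mat A *v e1)"
    "polar_line e1 = polar_line (rho_mat A *v ?v)"
    using L by (auto simp: carrier_POmega3 line_action_hyperbolic line_image_polar_line)
  have "rho_mat A *v e1 = ?v \<or> rho_mat A *v e1 = - ?v"
    using A(2) polar_line_eq_iff[OF two v] qform_rho[OF A(1)] qform_e1 by metis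
  moreover have "rho_mat A *v ?v = e1 \<or> rho_mat A *v ?v = - e1"
    using A(3) polar_line_eq_iff[OF two qform_e1] qform_rho[OF A(1)] v by metis
  ultimately show False using interchange_imp_square[OF two A(1), of ?v] x by auto
qed

theorem theorem3p2:
  fixes q :: nat
  assumes "primepow q" and "odd q" and "CARD('k::{field,finite}) = q"
  shows "let L = hyperbolic_lines :: ('k ^ 3) set set set;
             S = orbital_scheme POmega3 L line_action
         in association_scheme L S
            \<and> \<not> symmetric_scheme S
            \<and> (q mod 4 = 1 \<longrightarrow> real (num_classes L S) = (3 * real q + 5) / 4)
            \<and> (q mod 4 = 3 \<longrightarrow> real (num_classes L S) = (3 * real q + 3) / 4)"
proof -
  let ?L = "hyperbolic_lines :: ('k ^ 3) set set set"
  let ?S = "orbital_scheme POmega3 ?L line_action"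
  have odd: "odd CARD('k)" using assms by simp
  interpret transitive_maps POmega3 ?L line_action
    by (rule transitive_maps_POmega3[OF two_neq_zero_of_odd_card[OF odd]])
  define a where "a = card {s :: 'k. quad_char s = 1 \<and> quad_char (1 - s) = 1}"
  have card: "card ?S
      = 2 + (if quad_char (-1 :: 'k) = 1 then 2 else 1) + card {s :: 'k. quad_char s = 1} + a"
    unfolding a_def card_orbital_scheme_POmega3[OF odd] by (rule card_orbital_inv_image[OF odd])
  have q: "2 * card {s :: 'k. quad_char s = 1} + 1 = q"
    using card_quad_char_1[OF odd] assms(3) by simp
  have "quad_char (-1 :: 'k) = 1 \<or> quad_char (-1 :: 'k) = -1" by (rule quad_char_cases) simp
  then have classes: "q = 4 * a + 5 \<and> num_classes ?L ?S = 3 * a + 5 \<or>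
      q = 4 * a + 3 \<and> num_classes ?L ?S = 3 * a + 3"
  proof
    assume "quad_char (-1 :: 'k) = 1"
    then show ?thesis
      using card_consecutive_squares(1)[OF odd] q card assms(3)
      by (simp add: a_def num_classes_orbital_scheme)
  next
    assume "quad_char (-1 :: 'k) = -1"
    then show ?thesis
      using card_consecutive_squares(2)[OF odd] q card assms(3)
      by (simp add: a_def num_classes_orbital_scheme)
  qed
  have "(4 * a + 5) mod 4 = 1" "(4 * a + 3) mod 4 = 3" by presburger+
  then show ?thesis
    using classes association_scheme_orbital_scheme not_symmetric_scheme_POmega3[OF odd]
    by (auto simp: Let_def)
qed

end
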